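(* Let $(M,\varphi,\xi,\eta,g)$ be an $\eta$-Einstein Kenmotsu pseudo-metric manifold of dimension higher than $3$. If $(g,V)$ is a Ricci soliton for some vector field $V$ on $M$, then $M$ is Einstein.
   Context: Let $M$ be a smooth manifold of dimension $2n+1$, $n\ge 1$. An almost contact pseudo-metric structure $(\varphi,\xi,\eta,g)$ on $M$ consists of a $(1,1)$-tensor field $\varphi$, a vector field $\xi$, a 1-form $\eta$ and a pseudo-Riemannian metric $g$ such that $\varphi^2=-I+\eta\otimes\xi$, $\eta(\xi)=1$, $\varphi\xi=0$, $\eta\circ\varphi=0$, and $g(\varphi X,\varphi Y)=g(X,Y)-\varepsilon\eta(X)\eta(Y)$ for all vector fields $X,Y$, where $\varepsilon=\pm1$; consequently $\eta(X)=\varepsilon g(X,\xi)$, $g(\varphi X,Y)=-g(X,\varphi Y)$ and $g(\xi,\xi)=\varepsilon$. It is a Kenmotsu pseudo-metric manifold if $(\nabla_X\varphi)Y=-\eta(Y)\varphi X-\varepsilon g(X,\varphi Y)\xi$ for all $X,Y$, where $\nabla$ is the Levi-Civita connection of $g$. Curvature: $R(X,Y)=[\nabla_X,\nabla_Y]-\nabla_{[X,Y]}$; $Ric(Y,Z)$ is the trace of $X\mapsto R(X,Y)Z$. $M$ is $\eta$-Einstein if $Ric(X,Y)=a\,g(X,Y)+b\,\eta(X)\eta(Y)$ for all $X,Y$, for some smooth functions $a,b$ on $M$; it is Einstein if moreover $b=0$. For a vector field $V$ on $M$, $(g,V)$ is a Ricci soliton if there is a constant $\lambda\in\mathbb{R}$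 with $(\pounds_Vg)(X,Y)+2Ric(X,Y)+2\lambda g(X,Y)=0$ for all $X,Y$, where $\pounds$ is the Lie derivative. *)

theory Defs
  imports "HOL-Analysis.Analysis" "HOL-Library.Function_Algebras"
begin

section \<open>Pointwise vector space structure on functions\<close>

instantiation "fun" :: (type, real_vector) real_vector
begin

definition scaleR_fun :: "real \<Rightarrow> ('a \<Rightarrow> 'b) \<Rightarrow> 'a \<Rightarrow> 'b" where
  "scaleR_fun c f = (\<lambda>x. c *\<^sub>R f x)"

instance
  by standard (simp_all add: scaleR_fun_def fun_eq_iff scaleR_add_right scaleR_add_left)

end

definition lin_on :: "'a::real_vector set \<Rightarrow> ('a \<Rightarrow> 'b::real_vector) \<Rightarrow> bool" where
  "lin_on S f \<longleftrightarrow>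
     (\<forall>v\<in>S. \<forall>w\<in>S. f (v + w) = f v + f w) \<and> (\<forall>c. \<forall>v\<in>S. f (c *\<^sub>R v) = c *\<^sub>R f v)"

text \<open>Trace of an endomorphism of a finite-dimensional subspace; it does not depend on the
  choice of the basis.\<close>

definition trace_on :: "'a::real_vector set \<Rightarrow> ('a \<Rightarrow> 'a) \<Rightarrow> real" where
  "trace_on S L =
     (let B = (SOME B. B \<subseteq> S \<and> independent B \<and> span B = S)
      in \<Sum>b\<in>B. representation B (L b) b)"


section \<open>Smooth manifolds\<close>

text \<open>Only meant for open sets, where it says that all iterated directional derivatives
  exist, are differentiable and are continuous.\<close>

primrec Ck_on :: "nat \<Rightarrow> 'a::euclidean_space set \<Rightarrow> ('a \<Rightarrow> 'b::real_normed_vector) \<Rightarrow> bool" where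
  "Ck_on 0 S f \<longleftrightarrow> continuous_on S f"
| "Ck_on (Suc k) S f \<longleftrightarrow> (\<forall>x\<in>S. f differentiable (at x)) \<and>
     (\<forall>u. Ck_on k S (\<lambda>x. frechet_derivative f (at x) u))"

definition smooth_on :: "'a::euclidean_space set \<Rightarrow> ('a \<Rightarrow> 'b::real_normed_vector) \<Rightarrow> bool" where
  "smooth_on S f \<longleftrightarrow> (\<forall>k. Ck_on k S f)"

text \<open>A chart is a pair of its domain and its coordinate map; the values of the coordinate map
  outside the domain are irrelevant. The manifold is the whole type \<^typ>\<open>'m\<close>.\<close>

type_synonym ('m, 'e) chart = "'m set \<times> ('m \<Rightarrow> 'e)"

definition is_chart :: "('m::topological_space, 'e::euclidean_space) chart \<Rightarrow> bool" where
  "is_chart c \<longleftrightarrow> (case c of (U, \<phi>) \<Rightarrow>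
     open U \<and> open (\<phi> ` U) \<and> homeomorphism U (\<phi> ` U) \<phi> (inv_into U \<phi>))"

definition smooth_atlas ::
  "('m::{t2_space,second_countable_topology}, 'e::euclidean_space) chart set \<Rightarrow> bool" where
  "smooth_atlas A \<longleftrightarrow>
     (\<forall>c\<in>A. is_chart c) \<and> (\<Union>(U, \<phi>)\<in>A. U) = UNIV \<and>
     (\<forall>(U, \<phi>)\<in>A. \<forall>(W, \<psi>)\<in>A. smooth_on (\<phi> ` (U \<inter> W)) (\<psi> \<circ> inv_into U \<phi>))"

definition smooth_fun_on ::
  "('m, 'e::euclidean_space) chart set \<Rightarrow> 'm set \<Rightarrow> ('m \<Rightarrow> real) \<Rightarrow> bool" where
  "smooth_fun_on A W f \<longleftrightarrow> (\<forall>(U, \<phi>)\<in>A. smooth_on (\<phi> ` (U \<inter> W)) (f \<circ> inv_into U \<phi>))"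

definition smooth_near ::
  "('m::topological_space, 'e::euclidean_space) chart set \<Rightarrow> 'm \<Rightarrow> ('m \<Rightarrow> real) \<Rightarrow> bool" where
  "smooth_near A p f \<longleftrightarrow> (\<exists>W. open W \<and> p \<in> W \<and> smooth_fun_on A W f)"


section \<open>Tangent vectors and vector fields\<close>

text \<open>A tangent vector at \<open>p\<close> is a directional derivative operator, acting on the real functions
  that are smooth near \<open>p\<close>; by convention it maps all other functions to \<open>0\<close>, so that equality of
  tangent vectors is equality of functions.\<close>

type_synonym 'm tangent = "('m \<Rightarrow> real) \<Rightarrow> real"
type_synonym 'm field = "'m \<Rightarrow> 'm tangent"

definition coord_vector ::
  "('m::topological_space, 'e::euclidean_space) chart set \<Rightarrow> ('m, 'e) chart \<Rightarrow> 'm \<Rightarrow> 'e \<Rightarrow> 'm tangent"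
  where
  "coord_vector A c p u = (case c of (U, \<phi>) \<Rightarrow> \<lambda>f.
     if smooth_near A p f then frechet_derivative (f \<circ> inv_into U \<phi>) (at (\<phi> p)) u else 0)"

definition tangent_space ::
  "('m::topological_space, 'e::euclidean_space) chart set \<Rightarrow> 'm \<Rightarrow> 'm tangent set" where
  "tangent_space A p = {v. \<exists>c\<in>A. p \<in> fst c \<and> (\<exists>u. v = coord_vector A c p u)}"

definition appl :: "'m field \<Rightarrow> ('m \<Rightarrow> real) \<Rightarrow> 'm \<Rightarrow> real" where
  "appl X f = (\<lambda>p. X p f)"

definition fields ::
  "('m::topological_space, 'e::euclidean_space) chart set \<Rightarrow> 'm field set" where
  "fields A = {X. (\<forall>p. X p \<in> tangent_space A p) \<and>
     (\<forall>W f. open W \<longrightarrow> smooth_fun_on A W f \<longrightarrow> smooth_fun_on A W (appl X f))}"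

definition fscale :: "('m \<Rightarrow> real) \<Rightarrow> 'm field \<Rightarrow> 'm field" where
  "fscale f X = (\<lambda>p. f p *\<^sub>R X p)"

definition bracket ::
  "('m::topological_space, 'e::euclidean_space) chart set \<Rightarrow> 'm field \<Rightarrow> 'm field \<Rightarrow> 'm field" where
  "bracket A X Y = (\<lambda>p f.
     if smooth_near A p f then appl X (appl Y f) p - appl Y (appl X f) p else 0)"


section \<open>Tensor fields\<close>

text \<open>Tensor fields are given by their values at points; values outside the tangent spaces are
  irrelevant.\<close>

type_synonym 'm form = "'m \<Rightarrow> 'm tangent \<Rightarrow> real"
type_synonym 'm bilin = "'m \<Rightarrow> 'm tangent \<Rightarrow> 'm tangent \<Rightarrow> real"
type_synonym 'm endo = "'m \<Rightarrow> 'm tangent \<Rightarrow> 'm tangent"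

definition app1 :: "'m form \<Rightarrow> 'm field \<Rightarrow> 'm \<Rightarrow> real" where
  "app1 \<eta> X = (\<lambda>p. \<eta> p (X p))"

definition app2 :: "'m bilin \<Rightarrow> 'm field \<Rightarrow> 'm field \<Rightarrow> 'm \<Rightarrow> real" where
  "app2 g X Y = (\<lambda>p. g p (X p) (Y p))"

definition appE :: "'m endo \<Rightarrow> 'm field \<Rightarrow> 'm field" where
  "appE F X = (\<lambda>p. F p (X p))"

definition one_form ::
  "('m::topological_space, 'e::euclidean_space) chart set \<Rightarrow> 'm form \<Rightarrow> bool" where
  "one_form A \<eta> \<longleftrightarrow> (\<forall>p. lin_on (tangent_space A p) (\<eta> p)) \<and>
     (\<forall>X\<in>fields A. smooth_fun_on A UNIV (app1 \<eta> X))"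

definition endo_field ::
  "('m::topological_space, 'e::euclidean_space) chart set \<Rightarrow> 'm endo \<Rightarrow> bool" where
  "endo_field A F \<longleftrightarrow>
     (\<forall>p. lin_on (tangent_space A p) (F p) \<and> F p ` tangent_space A p \<subseteq> tangent_space A p) \<and>
     (\<forall>X\<in>fields A. appE F X \<in> fields A)"

definition pseudo_metric ::
  "('m::topological_space, 'e::euclidean_space) chart set \<Rightarrow> 'm bilin \<Rightarrow> bool" where
  "pseudo_metric A g \<longleftrightarrow>
     (\<forall>p. let T = tangent_space A p in
        (\<forall>v\<in>T. lin_on T (g p v)) \<and>
        (\<forall>v\<in>T. \<forall>w\<in>T. g p v w = g p w v) \<and>
        (\<forall>v\<in>T. (\<forall>w\<in>T. g p v w = 0) \<longrightarrow> v = 0)) \<and>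
     (\<forall>X\<in>fields A. \<forall>Y\<in>fields A. smooth_fun_on A UNIV (app2 g X Y))"

definition lie_deriv2 ::
  "('m::topological_space, 'e::euclidean_space) chart set \<Rightarrow> 'm field \<Rightarrow> 'm bilin \<Rightarrow>
     'm field \<Rightarrow> 'm field \<Rightarrow> 'm \<Rightarrow> real" where
  "lie_deriv2 A V g X Y =
     appl V (app2 g X Y) - app2 g (bracket A V X) Y - app2 g X (bracket A V Y)"


section \<open>Levi-Civita connection and curvature\<close>

type_synonym 'm connection = "'m field \<Rightarrow> 'm field \<Rightarrow> 'm field"

definition affine_connection ::
  "('m::topological_space, 'e::euclidean_space) chart set \<Rightarrow> 'm connection \<Rightarrow> bool" where
  "affine_connection A nab \<longleftrightarrow>
     (\<forall>X\<in>fields A. \<forall>Y\<in>fields A. nab X Y \<in> fields A) \<and>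
     (\<forall>X\<in>fields A. \<forall>Y\<in>fields A. \<forall>Z\<in>fields A.
        nab (X + Y) Z = nab X Z + nab Y Z \<and> nab X (Y + Z) = nab X Y + nab X Z) \<and>
     (\<forall>X\<in>fields A. \<forall>Y\<in>fields A. \<forall>f. smooth_fun_on A UNIV f \<longrightarrow>
        nab (fscale f X) Y = fscale f (nab X Y) \<and>
        nab X (fscale f Y) = fscale (appl X f) Y + fscale f (nab X Y))"

definition levi_civita ::
  "('m::topological_space, 'e::euclidean_space) chart set \<Rightarrow> 'm bilin \<Rightarrow> 'm connection \<Rightarrow> bool" where
  "levi_civita A g nab \<longleftrightarrow> affine_connection A nab \<and>
     (\<forall>X\<in>fields A. \<forall>Y\<in>fields A. nab X Y - nab Y X = bracket A X Y) \<and>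
     (\<forall>X\<in>fields A. \<forall>Y\<in>fields A. \<forall>Z\<in>fields A.
        appl X (app2 g Y Z) = app2 g (nab X Y) Z + app2 g Y (nab X Z))"

definition curvature ::
  "('m::topological_space, 'e::euclidean_space) chart set \<Rightarrow> 'm connection \<Rightarrow>
     'm field \<Rightarrow> 'm field \<Rightarrow> 'm field \<Rightarrow> 'm field" where
  "curvature A nab X Y Z = nab X (nab Y Z) - nab Y (nab X Z) - nab (bracket A X Y) Z"

text \<open>The endomorphism of the tangent space at \<open>p\<close> induced by an endomorphism \<open>L\<close> of the module of
  vector fields that is linear over smooth functions: extend the tangent vector \<open>v\<close> to a vector
  field, apply \<open>L\<close>, and evaluate at \<open>p\<close>. By linearity the extension does not matter.\<close>

definition at_point ::
  "('m::topological_space, 'e::euclidean_space) chart set \<Rightarrow> ('m field \<Rightarrow> 'm field) \<Rightarrow> 'm endo" where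
  "at_point A L p v = L (SOME X. X \<in> fields A \<and> X p = v) p"

definition Ric ::
  "('m::topological_space, 'e::euclidean_space) chart set \<Rightarrow> 'm connection \<Rightarrow>
     'm field \<Rightarrow> 'm field \<Rightarrow> 'm \<Rightarrow> real" where
  "Ric A nab Y Z = (\<lambda>p. trace_on (tangent_space A p) (at_point A (\<lambda>X. curvature A nab X Y Z) p))"


section \<open>Kenmotsu pseudo-metric manifolds and Ricci solitons\<close>

definition almost_contact_pseudo_metric ::
  "('m::topological_space, 'e::euclidean_space) chart set \<Rightarrow> real \<Rightarrow>
     'm endo \<Rightarrow> 'm field \<Rightarrow> 'm form \<Rightarrow> 'm bilin \<Rightarrow> bool" where
  "almost_contact_pseudo_metric A \<epsilon> \<phi> \<xi> \<eta> g \<longleftrightarrow>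
     endo_field A \<phi> \<and> \<xi> \<in> fields A \<and> one_form A \<eta> \<and> pseudo_metric A g \<and>
     \<epsilon> \<in> {1, -1} \<and>
     (\<forall>X\<in>fields A. appE \<phi> (appE \<phi> X) = - X + fscale (app1 \<eta> X) \<xi>) \<and>
     (\<forall>p. app1 \<eta> \<xi> p = 1) \<and>
     appE \<phi> \<xi> = 0 \<and>
     (\<forall>X\<in>fields A. \<forall>p. app1 \<eta> (appE \<phi> X) p = 0) \<and>
     (\<forall>X\<in>fields A. \<forall>Y\<in>fields A. \<forall>p.
        app2 g (appE \<phi> X) (appE \<phi> Y) p = app2 g X Y p - \<epsilon> * app1 \<eta> X p * app1 \<eta> Y p)"

text \<open>The left-hand side below is \<open>(\<nabla>\<^sub>X \<phi>) Y\<close>.\<close>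

definition kenmotsu_pseudo_metric ::
  "('m::topological_space, 'e::euclidean_space) chart set \<Rightarrow> real \<Rightarrow>
     'm endo \<Rightarrow> 'm field \<Rightarrow> 'm form \<Rightarrow> 'm bilin \<Rightarrow> 'm connection \<Rightarrow> bool" where
  "kenmotsu_pseudo_metric A \<epsilon> \<phi> \<xi> \<eta> g nab \<longleftrightarrow>
     almost_contact_pseudo_metric A \<epsilon> \<phi> \<xi> \<eta> g \<and> levi_civita A g nab \<and>
     (\<forall>X\<in>fields A. \<forall>Y\<in>fields A.
        nab X (appE \<phi> Y) - appE \<phi> (nab X Y) =
          - fscale (app1 \<eta> Y) (appE \<phi> X) - fscale (\<lambda>p. \<epsilon> * app2 g X (appE \<phi> Y) p) \<xi>)"

definition eta_einstein_with ::
  "('m::topological_space, 'e::euclidean_space) chart set \<Rightarrow> 'm form \<Rightarrow> 'm bilin \<Rightarrow>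
     'm connection \<Rightarrow> ('m \<Rightarrow> real) \<Rightarrow> ('m \<Rightarrow> real) \<Rightarrow> bool" where
  "eta_einstein_with A \<eta> g nab a b \<longleftrightarrow>
     smooth_fun_on A UNIV a \<and> smooth_fun_on A UNIV b \<and>
     (\<forall>X\<in>fields A. \<forall>Y\<in>fields A. \<forall>p.
        Ric A nab X Y p = a p * app2 g X Y p + b p * app1 \<eta> X p * app1 \<eta> Y p)"

definition eta_einstein ::
  "('m::topological_space, 'e::euclidean_space) chart set \<Rightarrow> 'm form \<Rightarrow> 'm bilin \<Rightarrow>
     'm connection \<Rightarrow> bool" where
  "eta_einstein A \<eta> g nab \<longleftrightarrow> (\<exists>a b. eta_einstein_with A \<eta> g nab a b)"

definition einstein ::
  "('m::topological_space, 'e::euclidean_space) chart set \<Rightarrow> 'm form \<Rightarrow> 'm bilin \<Rightarrow>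
     'm connection \<Rightarrow> bool" where
  "einstein A \<eta> g nab \<longleftrightarrow> (\<exists>a. eta_einstein_with A \<eta> g nab a (\<lambda>p. 0))"

definition ricci_soliton ::
  "('m::topological_space, 'e::euclidean_space) chart set \<Rightarrow> 'm bilin \<Rightarrow> 'm connection \<Rightarrow>
     'm field \<Rightarrow> bool" where
  "ricci_soliton A g nab V \<longleftrightarrow> V \<in> fields A \<and>
     (\<exists>lam::real. \<forall>X\<in>fields A. \<forall>Y\<in>fields A. \<forall>p.
        lie_deriv2 A V g X Y p + 2 * Ric A nab X Y p + 2 * lam * app2 g X Y p = 0)"

end

theory Submission
  imports Defs
begin

text \<open>
  Write \<open>\<eta>\<close>-Einstein as \<open>Ric = a g + b \<eta> \<otimes> \<eta>\<close>; the claim is \<open>b = 0\<close>. Locally a Kenmotsu manifold is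
  a warped product of a line, with coordinate \<open>t\<close> and unit field \<open>\<xi>\<close>, and a Kaehler manifold, with
  warping factor \<open>exp (2 t)\<close>. In this picture \<open>b\<close> decays like \<open>exp (- 2 t)\<close> with a factor that
  measures the Ricci curvature of the leaves. The soliton equation forces \<open>f = \<eta>(V)\<close> to have, on each
  leaf, a Hessian that is a multiple of the metric, and such a function has no room on a Kaehler
  manifold of real dimension at least four unless the factor is constant along the leaves and the
  gradient is a null direction of the Ricci curvature. Hence the leaves are Ricci flat wherever the
  leafwise gradient of \<open>f\<close> does not vanish; and on an open set where it vanishes, so does the
  Hessian, whose factor turns out to be \<open>2 b\<close> up to the warping.

  The formal argument replaces this picture by identities between vector fields. From the structure
  equations come \<open>R(X, Y)\<xi> = \<eta>(X) Y - \<eta>(Y) X\<close>, hence \<open>a = - \<epsilon> (2 n + b)\<close>, and the fact that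
  the modified curvature \<open>K(X, Y) U = R(X, Y) U + \<epsilon> (g(Y, U) X - g(X, U) Y)\<close> commutes with \<open>\<phi>\<close>
  (\<open>K_phi\<close>), has the pair symmetry, and is invariant under the flow of \<open>\<xi>\<close> (\<open>lie_curvature\<close>). The
  trace of the last statement is \<open>\<xi> b = - 2 b\<close> (\<open>appl_xi_b\<close>).

  The \<open>\<xi>\<close> component of the soliton equation identifies the gradient of \<open>f\<close>, up to sign and a
  multiple of \<open>\<xi>\<close>, with the bracket \<open>[\<xi>, V]\<close>. Its Hessian is then found from
  \<open>\<L>\<^bsub>[\<xi>, V]\<^esub> g = \<L>\<^bsub>\<xi>\<^esub> \<L>\<^bsub>V\<^esub> g - \<L>\<^bsub>V\<^esub> \<L>\<^bsub>\<xi>\<^esub> g\<close>, where all terms on the right are known (\<open>hessian\<close>).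
  For the horizontal part \<open>Z\<close> of the gradient this gives \<open>K(X, Y) Z\<close> in terms of a single 1-form
  \<open>\<alpha>\<close> (\<open>K_Z\<close>). The symmetries of \<open>K\<close> kill \<open>\<alpha>\<close> because the dimension exceeds three (\<open>\<alpha>_zero\<close>),
  so \<open>K(X, Y) Z = 0\<close>, and the trace of this is \<open>b Z = 0\<close> (\<open>b_Z\<close>). Moreover \<open>\<alpha>(\<xi>) = 0\<close> yields
  that the covariant derivative of \<open>Z\<close> is \<open>2 b\<close> times the horizontal projection, up to terms that contain \<open>Z\<close>;
  so \<open>b = 0\<close> follows by differentiating \<open>b Z = 0\<close> (\<open>b_zero\<close>).

  Two analytic facts are behind the pointwise arguments: every tangent vector extends to a global
  vector field (\<open>field_extension\<close>), which needs bump functions, and the Lie derivative commutes with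
  the trace of a tensorial operator (\<open>appl_trace\<close>), which needs coordinate frames.
\<close>

section \<open>Smooth functions on Euclidean spaces\<close>

lemma Ck_on_cong:
  assumes "open S" "Ck_on k S f" "\<And>x. x \<in> S \<Longrightarrow> f x = h x"
  shows "Ck_on k S h"
  using assms(2,3)
proof (induction k arbitrary: f h)
  case 0
  then show ?case by (simp cong: continuous_on_cong)
next
  case (Suc k)
  show ?case
    unfolding Ck_on.simps
  proof (intro conjI ballI allI)
    fix x assume x: "x \<in> S"
    then have "f differentiable at x" using Suc.prems by simp
    then show "h differentiable at x"
      unfolding differentiable_def
      using has_derivative_transform_within_open[OF _ assms(1) x, of f _ _ h] Suc.prems(2) by blast
  next
    fix u
    show "Ck_on k S (\<lambda>x. frechet_derivative h (at x) u)"
    proof (rule Suc.IH[of "\<lambda>x. frechet_derivative f (at x) u"])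
      show "Ck_on k S (\<lambda>x. frechet_derivative f (at x) u)" using Suc.prems by simp
      fix x assume x: "x \<in> S"
      then have "f differentiable at x" using Suc.prems by simp
      then show "frechet_derivative f (at x) u = frechet_derivative h (at x) u"
        using frechet_derivative_transform_within_open[OF _ assms(1) x, of f h] Suc.prems(2) by metis
    qed
  qed
qed

text \<open>The derivative in the definition of \<open>Ck_on\<close> may be replaced by any family of linear maps that
  agrees with it on the open set \<open>S\<close>; only there do its values matter.\<close>

lemma Ck_on_SucI:
  assumes "\<And>x. x \<in> S \<Longrightarrow> (f has_derivative f' x) (at x)" and "\<And>u. Ck_on k S (\<lambda>x. f' x u)"
    and "open S"
  shows "Ck_on (Suc k) S f"
proof -
  have "f' x = frechet_derivative f (at x)" if "x \<in> S" for x
    using assms(1)[OF that] by (rule frechet_derivative_at)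
  then have "Ck_on k S (\<lambda>x. frechet_derivative f (at x) u)" for u
    by (intro Ck_on_cong[OF assms(3) assms(2)[of u]]) simp
  then show ?thesis
    using assms(1) by (auto simp: differentiable_def)
qed

lemma Ck_on_SucD:
  assumes "Ck_on (Suc k) S f"
  shows "\<exists>f'. (\<forall>x\<in>S. (f has_derivative f' x) (at x)) \<and> (\<forall>u. Ck_on k S (\<lambda>x. f' x u))"
  using assms
  by (intro exI[of _ "\<lambda>x. frechet_derivative f (at x)"])
    (auto simp: frechet_derivative_works[symmetric])

lemma Ck_on_lower: "Ck_on (Suc k) S f \<Longrightarrow> Ck_on k S f"
proof (induction k arbitrary: f)
  case 0
  then show ?case
    by (simp add: continuous_at_imp_continuous_on differentiable_imp_continuous_within)
next
  case (Suc k)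
  show ?case
    unfolding Ck_on.simps(2)
  proof (intro conjI allI)
    show "\<forall>x\<in>S. f differentiable at x" using Suc.prems by simp
    show "Ck_on k S (\<lambda>x. frechet_derivative f (at x) u)" for u
      using Suc.prems Suc.IH[of "\<lambda>x. frechet_derivative f (at x) u"] Ck_on.simps(2)[of "Suc k" S f]
      by blast
  qed
qed

lemma Ck_on_subset: "Ck_on k S f \<Longrightarrow> T \<subseteq> S \<Longrightarrow> Ck_on k T f"
  by (induction k arbitrary: f) (auto intro: continuous_on_subset)

lemma Ck_on_local:
  assumes "\<And>x. x \<in> S \<Longrightarrow> \<exists>N. open N \<and> x \<in> N \<and> Ck_on k N f"
  shows "Ck_on k S f"
  using assms
proof (induction k arbitrary: f)
  case 0
  show ?case unfolding Ck_on.simps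
  proof (rule continuous_at_imp_continuous_on, rule ballI)
    fix x assume "x \<in> S"
    then obtain N where "open N" "x \<in> N" "continuous_on N f" using 0 by force
    then show "continuous (at x) f" by (simp add: continuous_on_eq_continuous_at)
  qed
next
  case (Suc k)
  show ?case
    unfolding Ck_on.simps
  proof (intro conjI ballI allI)
    show "f differentiable at x" if "x \<in> S" for x using Suc.prems[OF that] by auto
    show "Ck_on k S (\<lambda>x. frechet_derivative f (at x) u)" for u
    proof (rule Suc.IH)
      fix x assume "x \<in> S"
      then show "\<exists>N. open N \<and> x \<in> N \<and> Ck_on k N (\<lambda>x. frechet_derivative f (at x) u)"
        using Suc.prems by force
    qed
  qed
qed

lemma Ck_on_const: "open S \<Longrightarrow> Ck_on k S (\<lambda>x. c)"
proof (induction k arbitrary: c)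
  case (Suc k)
  then show ?case by (intro Ck_on_SucI[where f' = "\<lambda>x u. 0"]) auto
qed simp

lemma Ck_on_bounded_linear:
  assumes "open S" "bounded_linear h"
  shows "Ck_on k S h"
proof (cases k)
  case 0
  then show ?thesis
    by (simp add: assms(2) linear_continuous_on)
next
  case (Suc j)
  show ?thesis unfolding Suc
    by (rule Ck_on_SucI[where f' = "\<lambda>x. h"])
      (auto intro: bounded_linear_imp_has_derivative Ck_on_const assms)
qed

lemma Ck_on_linear_compose:
  assumes "open S" "bounded_linear h" "Ck_on k S f"
  shows "Ck_on k S (\<lambda>x. h (f x))"
  using assms(3)
proof (induction k arbitrary: f)
  case 0
  then show ?case
    by (simp add: assms(2) bounded_linear.continuous_on)
next
  case (Suc k)
  from Ck_on_SucD[OF Suc.prems] obtain f' where f': "\<And>x. x \<in> S \<Longrightarrow> (f has_derivative f' x) (at x)"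
    "\<And>u. Ck_on k S (\<lambda>x. f' x u)" by blast
  show ?case
    by (rule Ck_on_SucI[where f' = "\<lambda>x u. h (f' x u)"])
      (auto intro!: bounded_linear.has_derivative[OF assms(2)] f' Suc.IH assms)
qed

lemma Ck_on_add:
  assumes "open S" "Ck_on k S f" "Ck_on k S h"
  shows "Ck_on k S (\<lambda>x. f x + h x)"
  using assms(2,3)
proof (induction k arbitrary: f h)
  case 0
  then show ?case by (simp add: continuous_on_add)
next
  case (Suc k)
  obtain f' where f': "\<And>x. x \<in> S \<Longrightarrow> (f has_derivative f' x) (at x)"
    "\<And>u. Ck_on k S (\<lambda>x. f' x u)" using Ck_on_SucD[OF Suc.prems(1)] by blast
  obtain h' where h': "\<And>x. x \<in> S \<Longrightarrow> (h has_derivative h' x) (at x)"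
    "\<And>u. Ck_on k S (\<lambda>x. h' x u)" using Ck_on_SucD[OF Suc.prems(2)] by blast
  show ?case
    by (rule Ck_on_SucI[where f' = "\<lambda>x u. f' x u + h' x u"])
      (auto intro!: has_derivative_add f' h' Suc.IH assms)
qed

lemma Ck_on_scaleR:
  fixes f :: "'a::euclidean_space \<Rightarrow> real"
  assumes "open S" "Ck_on k S f" "Ck_on k S h"
  shows "Ck_on k S (\<lambda>x. f x *\<^sub>R h x)"
  using assms(2,3)
proof (induction k arbitrary: f h)
  case 0
  then show ?case by (simp add: continuous_on_scaleR)
next
  case (Suc k)
  obtain f' where f': "\<And>x. x \<in> S \<Longrightarrow> (f has_derivative f' x) (at x)"
    "\<And>u. Ck_on k S (\<lambda>x. f' x u)" using Ck_on_SucD[OF Suc.prems(1)] by blast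
  obtain h' where h': "\<And>x. x \<in> S \<Longrightarrow> (h has_derivative h' x) (at x)"
    "\<And>u. Ck_on k S (\<lambda>x. h' x u)" using Ck_on_SucD[OF Suc.prems(2)] by blast
  show ?case
    by (rule Ck_on_SucI[where f' = "\<lambda>x u. f x *\<^sub>R h' x u + f' x u *\<^sub>R h x"])
      (auto intro!: has_derivative_scaleR f' h' Suc.IH assms Ck_on_add Suc.prems[THEN Ck_on_lower])
qed

lemma Ck_on_sum:
  assumes "open S" "finite I" "\<And>i. i \<in> I \<Longrightarrow> Ck_on k S (f i)"
  shows "Ck_on k S (\<lambda>x. \<Sum>i\<in>I. f i x)"
  using assms(2,3)
  by (induction I rule: finite_induct) (auto intro!: Ck_on_const Ck_on_add assms(1))

text \<open>Expanding the outer derivative in the standard basis turns the chain rule into a sum of products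
  of functions that are smooth of one order less, so that the induction goes through.\<close>

lemma Ck_on_compose:
  fixes g :: "'a::euclidean_space \<Rightarrow> 'b::euclidean_space"
  assumes "open S" "open T" "g ` S \<subseteq> T" "Ck_on k S g" "Ck_on k T f"
  shows "Ck_on k S (\<lambda>x. f (g x))"
  using assms(4,5)
proof (induction k arbitrary: f)
  case 0
  then show ?case
    using continuous_on_compose2[of T f S g] assms(3) by simp
next
  case (Suc k)
  obtain g' where g': "\<And>x. x \<in> S \<Longrightarrow> (g has_derivative g' x) (at x)"
    "\<And>u. Ck_on k S (\<lambda>x. g' x u)" using Ck_on_SucD[OF Suc.prems(1)] by blast
  obtain f' where f': "\<And>x. x \<in> T \<Longrightarrow> (f has_derivative f' x) (at x)"
    "\<And>u. Ck_on k T (\<lambda>x. f' x u)" using Ck_on_SucD[OF Suc.prems(2)] by blast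
  have chain: "((\<lambda>x. f (g x)) has_derivative (\<lambda>u. \<Sum>b\<in>Basis. (g' x u \<bullet> b) *\<^sub>R f' (g x) b)) (at x)"
    if x: "x \<in> S" for x
  proof -
    have gx: "g x \<in> T" using x assms(3) by auto
    have expand: "f' (g x) v = (\<Sum>b\<in>Basis. (v \<bullet> b) *\<^sub>R f' (g x) b)" for v
    proof -
      have lin: "linear (f' (g x))" using f'(1)[OF gx] has_derivative_linear by blast
      have "f' (g x) v = f' (g x) (\<Sum>b\<in>Basis. (v \<bullet> b) *\<^sub>R b)" by (simp add: euclidean_representation)
      then show ?thesis by (simp add: linear_sum[OF lin] linear_cmul[OF lin])
    qed
    have "((\<lambda>x. f (g x)) has_derivative (\<lambda>u. f' (g x) (g' x u))) (at x)"
      using diff_chain_at[OF g'(1)[OF x] f'(1)[OF gx]] by (simp add: o_def)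
    also have "(\<lambda>u. f' (g x) (g' x u)) = (\<lambda>u. \<Sum>b\<in>Basis. (g' x u \<bullet> b) *\<^sub>R f' (g x) b)"
      using expand by (rule ext)
    finally show ?thesis .
  qed
  show ?case
  proof (rule Ck_on_SucI[OF chain])
    show "Ck_on k S (\<lambda>x. \<Sum>b\<in>Basis. (g' x u \<bullet> b) *\<^sub>R f' (g x) b)" for u
      by (intro Ck_on_sum Ck_on_scaleR Suc.IH f'(2) Ck_on_lower[OF Suc.prems(1)]
          Ck_on_linear_compose[OF _ bounded_linear_inner_left g'(2)] assms finite_Basis)
  qed (use assms in auto)
qed

text \<open>For \<open>p = 1\<close> this is the standard function that is flat at the origin. The polynomial factor makes
  the family closed under differentiation, which gives smoothness by induction on the order.\<close>

definition flat_exp :: "real poly \<Rightarrow> real \<Rightarrow> real" where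
  "flat_exp p x = (if x > 0 then poly p (1 / x) * exp (- (1 / x)) else 0)"

lemma flat_exp_tendsto_0: "((\<lambda>y. poly p y * exp (- y)) \<longlongrightarrow> (0::real)) at_top"
proof -
  have "((\<lambda>y. \<Sum>i\<le>degree p. coeff p i * (y ^ i / exp y)) \<longlongrightarrow> (\<Sum>i\<le>degree p. coeff p i * 0)) at_top"
    by (intro tendsto_intros tendsto_power_div_exp_0)
  then show ?thesis
    by (simp add: poly_altdef exp_minus divide_inverse sum_distrib_left mult_ac)
qed

lemma flat_exp_has_derivative:
  "(flat_exp p has_field_derivative flat_exp ([:0, 0, 1:] * (p - pderiv p)) x) (at x)"
proof -
  let ?q = "[:0, 0, 1:] * (p - pderiv p)"
  consider "x > 0" | "x < 0" | "x = 0" by linarith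
  then show ?thesis
  proof cases
    case 1
    have "((\<lambda>x. poly p (1 / x) * exp (- (1 / x))) has_field_derivative
        poly ?q (1 / x) * exp (- (1 / x))) (at x)"
      using 1
      apply (auto intro!: derivative_eq_intros poly_DERIV[THEN DERIV_chain2])
      apply (simp add: field_simps power2_eq_square)
      done
    then have "(flat_exp p has_field_derivative poly ?q (1 / x) * exp (- (1 / x))) (at x)"
      by (rule has_field_derivative_transform_within_open[where S = "{0<..}"])
        (use 1 in \<open>auto simp: flat_exp_def\<close>)
    then show ?thesis using 1 by (simp add: flat_exp_def)
  next
    case 2
    have "((\<lambda>x. 0) has_field_derivative (0::real)) (at x)" by simp
    then have "(flat_exp p has_field_derivative 0) (at x)"
      by (rule has_field_derivative_transform_within_open[where S = "{..<0}"])
        (use 2 in \<open>auto simp: flat_exp_def\<close>)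
    then show ?thesis using 2 by (simp add: flat_exp_def)
  next
    case 3
    have "((\<lambda>h. flat_exp p h / h) \<longlongrightarrow> 0) (at 0)"
    proof (rule filterlim_split_at)
      show "((\<lambda>h. flat_exp p h / h) \<longlongrightarrow> 0) (at_left 0)"
        by (rule tendsto_eventually) (auto simp: flat_exp_def eventually_at_left_field intro!: exI[of _ "-1"])
      have lim: "((\<lambda>h. poly ([:0, 1:] * p) (inverse h) * exp (- inverse h)) \<longlongrightarrow> 0) (at_right (0::real))"
        by (rule filterlim_compose[OF flat_exp_tendsto_0 filterlim_inverse_at_top_right])
      show "((\<lambda>h. flat_exp p h / h) \<longlongrightarrow> 0) (at_right 0)"
        by (rule Lim_transform_eventually[OF lim])
          (auto simp: flat_exp_def eventually_at_right_field divide_inverse intro!: exI[of _ 1])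
    qed
    then have "(flat_exp p has_field_derivative 0) (at 0)"
      by (simp add: DERIV_def flat_exp_def)
    then show ?thesis using 3 by (simp add: flat_exp_def)
  qed
qed

lemma Ck_on_flat_exp: "Ck_on k UNIV (flat_exp p)"
proof (induction k arbitrary: p)
  case 0
  then show ?case
    by (auto intro!: continuous_at_imp_continuous_on DERIV_isCont flat_exp_has_derivative)
next
  case (Suc k)
  let ?q = "[:0, 0, 1:] * (p - pderiv p)"
  show ?case
  proof (rule Ck_on_SucI)
    show "(flat_exp p has_derivative (\<lambda>u. u *\<^sub>R flat_exp ?q x)) (at x)" for x
    proof -
      have "(\<lambda>u. u *\<^sub>R flat_exp ?q x) = (*) (flat_exp ?q x)"
        by (simp add: fun_eq_iff mult.commute del: mult_pCons_left)
      then show ?thesis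
        using flat_exp_has_derivative[of p x] unfolding has_field_derivative_def by (simp only:)
    qed
    show "Ck_on k UNIV (\<lambda>x. u *\<^sub>R flat_exp ?q x)" for u
      by (intro Ck_on_scaleR Ck_on_const Suc.IH) auto
  qed auto
qed

text \<open>A smooth step obtained without division: \<open>e\<close> being the flat function, which increases on the
  positive axis, \<open>e (e 1 - e x)\<close> is constant for \<open>x \<le> 0\<close> and vanishes for \<open>x \<ge> 1\<close>.\<close>

lemma smooth_step_exists:
  obtains s :: "real \<Rightarrow> real" where "\<And>k. Ck_on k UNIV s" "\<And>x. x \<le> 0 \<Longrightarrow> s x = 1" "\<And>x. x \<ge> 1 \<Longrightarrow> s x = 0"
proof
  let ?e = "flat_exp 1"
  let ?s = "\<lambda>x. inverse (?e (?e 1)) *\<^sub>R ?e (?e 1 + - 1 *\<^sub>R ?e x)"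
  show "Ck_on k UNIV ?s" for k
    by (intro open_UNIV subset_UNIV Ck_on_scaleR Ck_on_const Ck_on_add Ck_on_flat_exp
        Ck_on_compose[where T = UNIV and f = ?e and g = "\<lambda>x. ?e 1 + - 1 *\<^sub>R ?e x"])
  show "?s x = 1" if "x \<le> 0" for x using that by (simp add: flat_exp_def)
  show "?s x = 0" if "x \<ge> 1" for x
  proof -
    have "1 / x \<le> 1" using that by simp
    then have "?e 1 - ?e x \<le> 0" using that by (simp add: flat_exp_def)
    then show ?thesis by (simp add: flat_exp_def)
  qed
qed

lemma bump_exists:
  fixes c :: "'a::euclidean_space"
  assumes "r > 0"
  obtains f :: "'a \<Rightarrow> real" and \<delta> where "\<And>k. Ck_on k UNIV f" "\<delta> > 0" "\<delta> \<le> r"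
    "\<And>x. dist c x < \<delta> \<Longrightarrow> f x = 1" "\<And>x. dist c x > r \<Longrightarrow> f x = 0"
proof -
  obtain s :: "real \<Rightarrow> real" where s: "\<And>k. Ck_on k UNIV s"
    "\<And>x. x \<le> 0 \<Longrightarrow> s x = 1" "\<And>x. x \<ge> 1 \<Longrightarrow> s x = 0" using smooth_step_exists by blast
  let ?q = "\<lambda>x. (2 / r\<^sup>2) *\<^sub>R ((x - c) \<bullet> (x - c)) + - 1"
  have sq: "Ck_on k UNIV (\<lambda>x. (x - c) \<bullet> (x - c))" for k
  proof (cases k)
    case (Suc j)
    have "Ck_on j UNIV (\<lambda>x. 2 *\<^sub>R ((x + - c) \<bullet> u))" for u
      by (intro Ck_on_scaleR Ck_on_linear_compose[OF _ bounded_linear_inner_left] Ck_on_add Ck_on_const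
          Ck_on_bounded_linear bounded_linear_ident) auto
    then have "Ck_on (Suc j) UNIV (\<lambda>x. (x - c) \<bullet> (x - c))"
      by (intro Ck_on_SucI[where f' = "\<lambda>x u. 2 * ((x - c) \<bullet> u)"])
        (auto intro!: derivative_eq_intros simp: inner_commute)
    then show ?thesis unfolding Suc .
  qed (auto intro!: continuous_intros)
  show ?thesis
  proof
    show "Ck_on k UNIV (\<lambda>x. s (?q x))" for k
      by (rule Ck_on_compose[where T = UNIV])
        (intro open_UNIV subset_UNIV s(1) Ck_on_add Ck_on_scaleR Ck_on_const sq)+
    show "r / 2 > 0" "r / 2 \<le> r" using assms by auto
    have q: "?q x = 2 * (dist c x / r)\<^sup>2 - 1" for x
      unfolding dist_commute[of c x] by (simp add: power_divide dist_norm power2_norm_eq_inner)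
    show "s (?q x) = 1" if "dist c x < r / 2" for x
    proof -
      have "dist c x / r \<le> 1 / 2" using that assms by (simp add: field_simps)
      then have "(dist c x / r)\<^sup>2 \<le> (1 / 2)\<^sup>2" using assms by (intro power_mono) auto
      moreover have "(1 / 2 :: real)\<^sup>2 = 1 / 4" by (simp add: power2_eq_square)
      ultimately have "?q x \<le> 0" unfolding q by linarith
      then show ?thesis by (rule s(2))
    qed
    show "s (?q x) = 0" if "dist c x > r" for x
    proof -
      have "1 \<le> dist c x / r" using that assms by (simp add: field_simps)
      then have "1\<^sup>2 \<le> (dist c x / r)\<^sup>2" using assms by (intro power_mono) auto
      then have "?q x \<ge> 1" unfolding q by simp
      then show ?thesis by (rule s(3))
    qed
  qed
qed

section \<open>Functions on a manifold\<close>

locale manifold =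
  fixes A :: "('m::{t2_space,second_countable_topology}, 'e::euclidean_space) chart set"
  assumes atlas: "smooth_atlas A"
begin

lemma chart_facts:
  assumes "(U, x) \<in> A"
  shows chart_open: "open U"
    and chart_inverse: "q \<in> U \<Longrightarrow> inv_into U x (x q) = q"
    and chart_image_open: "open N \<Longrightarrow> open (x ` (U \<inter> N))"
    and chart_continuous: "continuous_on U x"
    and chart_inverse_continuous: "continuous_on (x ` U) (inv_into U x)"
proof -
  have U: "open U" "open (x ` U)" and hom: "homeomorphism U (x ` U) x (inv_into U x)"
    using atlas assms by (auto simp: smooth_atlas_def is_chart_def)
  show "open U" by (fact U)
  show "q \<in> U \<Longrightarrow> inv_into U x (x q) = q" using hom by (auto simp: homeomorphism_def)
  show "continuous_on U x" "continuous_on (x ` U) (inv_into U x)"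
    using hom by (auto simp: homeomorphism_def)
  show "open (x ` (U \<inter> N))" if "open N"
  proof -
    have "openin (top_of_set U) (U \<inter> N)" using that by (simp add: openin_open_Int)
    then have "openin (top_of_set (x ` U)) (x ` (U \<inter> N))"
      by (rule homeomorphism_imp_open_map[OF hom])
    then show ?thesis using U(2) by (simp add: openin_open_eq)
  qed
qed

lemma chart_image_open_subset: "(U, x) \<in> A \<Longrightarrow> open N \<Longrightarrow> N \<subseteq> U \<Longrightarrow> open (x ` N)"
  using chart_image_open[of U x N] by (simp add: Int_absorb1)

lemma chart_exists: "\<exists>U x. (U, x) \<in> A \<and> p \<in> U"
proof -
  have "p \<in> (\<Union>(U, x)\<in>A. U)" using atlas by (simp add: smooth_atlas_def)
  then show ?thesis by auto
qed

lemma chart_transition: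
  "(U, x) \<in> A \<Longrightarrow> (W, y) \<in> A \<Longrightarrow> Ck_on k (x ` (U \<inter> W)) (y \<circ> inv_into U x)"
  using atlas unfolding smooth_atlas_def smooth_on_def split_beta by (metis fst_conv snd_conv)

lemma smooth_fun_onD:
  "smooth_fun_on A W f \<Longrightarrow> (U, x) \<in> A \<Longrightarrow> Ck_on k (x ` (U \<inter> W)) (\<lambda>z. f (inv_into U x z))"
  unfolding smooth_fun_on_def smooth_on_def split_beta o_def by (metis fst_conv snd_conv)

lemma smooth_fun_onI:
  "(\<And>U x k. (U, x) \<in> A \<Longrightarrow> Ck_on k (x ` (U \<inter> W)) (\<lambda>z. f (inv_into U x z))) \<Longrightarrow> smooth_fun_on A W f"
  unfolding smooth_fun_on_def smooth_on_def o_def by auto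

lemma smooth_fun_on_subset: "smooth_fun_on A W f \<Longrightarrow> W' \<subseteq> W \<Longrightarrow> smooth_fun_on A W' f"
  by (rule smooth_fun_onI, rule Ck_on_subset, rule smooth_fun_onD) auto

lemma smooth_fun_on_cong:
  assumes "smooth_fun_on A W f" "open W" "\<And>q. q \<in> W \<Longrightarrow> f q = h q"
  shows "smooth_fun_on A W h"
  by (rule smooth_fun_onI, rule Ck_on_cong[OF chart_image_open smooth_fun_onD[OF assms(1)]])
    (use assms chart_inverse in auto)

lemma smooth_fun_on_localI:
  assumes "\<And>p. p \<in> W \<Longrightarrow> \<exists>N. open N \<and> p \<in> N \<and> smooth_fun_on A N f"
  shows "smooth_fun_on A W f"
proof (rule smooth_fun_onI, rule Ck_on_local)
  fix U x k z assume c: "(U, x) \<in> A" and "z \<in> x ` (U \<inter> W)"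
  then obtain p where p: "p \<in> U" "p \<in> W" "z = x p" by auto
  then obtain N where "open N" "p \<in> N" "smooth_fun_on A N f" using assms by blast
  then show "\<exists>N. open N \<and> z \<in> N \<and> Ck_on k N (\<lambda>z. f (inv_into U x z))"
    using c p by (intro exI[of _ "x ` (U \<inter> N)"]) (auto intro: chart_image_open smooth_fun_onD)
qed

text \<open>Smoothness may be tested in a single chart because the transition maps are smooth.\<close>

lemma smooth_fun_on_chartI:
  assumes c: "(U, x) \<in> A" and N: "open N" "N \<subseteq> U"
    and f: "\<And>k. Ck_on k (x ` N) (\<lambda>z. f (inv_into U x z))"
  shows "smooth_fun_on A N f"
proof (rule smooth_fun_onI)
  fix W y k assume d: "(W, y) \<in> A"
  let ?S = "y ` (W \<inter> N)"
  have S: "open ?S" by (rule chart_image_open[OF d N(1)])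
  have t: "Ck_on k ?S (\<lambda>z. x (inv_into W y z))"
    using chart_transition[OF d c, of k] N by (auto simp: o_def elim!: Ck_on_subset)
  have "Ck_on k ?S (\<lambda>z. f (inv_into U x (x (inv_into W y z))))"
    by (rule Ck_on_compose[OF S chart_image_open_subset[OF c N] _ t f])
      (auto simp: chart_inverse[OF d])
  then show "Ck_on k ?S (\<lambda>z. f (inv_into W y z))"
    by (rule Ck_on_cong[OF S]) (use N in \<open>auto simp: chart_inverse[OF d] chart_inverse[OF c] subset_iff\<close>)
qed

lemma smooth_fun_on_const: "open W \<Longrightarrow> smooth_fun_on A W (\<lambda>_. c)"
  by (intro smooth_fun_onI Ck_on_const chart_image_open)

lemma smooth_fun_on_add:
  "open W \<Longrightarrow> smooth_fun_on A W f \<Longrightarrow> smooth_fun_on A W h \<Longrightarrow> smooth_fun_on A W (f + h)"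
  unfolding plus_fun_def
  by (rule smooth_fun_onI, rule Ck_on_add) (auto intro: chart_image_open smooth_fun_onD)

lemma smooth_fun_on_mult:
  "open W \<Longrightarrow> smooth_fun_on A W f \<Longrightarrow> smooth_fun_on A W h \<Longrightarrow> smooth_fun_on A W (f * h)"
  unfolding times_fun_def real_scaleR_def[symmetric]
  by (rule smooth_fun_onI, rule Ck_on_scaleR) (auto intro: chart_image_open smooth_fun_onD)

lemma smooth_fun_on_coordinate:
  assumes "(U, x) \<in> A" "W \<subseteq> U"
  shows "smooth_fun_on A W (\<lambda>q. x q \<bullet> b)"
proof -
  have "Ck_on k (x ` U) (\<lambda>z. x (inv_into U x z) \<bullet> b)" for k
    by (rule Ck_on_cong[OF _ Ck_on_bounded_linear[OF _ bounded_linear_inner_left]])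
      (auto simp: chart_inverse[OF assms(1)] intro!: chart_image_open_subset[OF assms(1)]
        chart_open[OF assms(1)])
  then have "smooth_fun_on A U (\<lambda>q. x q \<bullet> b)"
    using assms chart_open by (intro smooth_fun_on_chartI[of U x]) auto
  then show ?thesis by (rule smooth_fun_on_subset[OF _ assms(2)])
qed

lemma smooth_nearI: "smooth_fun_on A W f \<Longrightarrow> open W \<Longrightarrow> p \<in> W \<Longrightarrow> smooth_near A p f"
  unfolding smooth_near_def by blast

lemma smooth_near_combine:
  assumes "smooth_near A p f" "smooth_near A p h"
  obtains W where "open W" "p \<in> W" "smooth_fun_on A W f" "smooth_fun_on A W h"
proof -
  obtain V W where "open V" "p \<in> V" "smooth_fun_on A V f" "open W" "p \<in> W" "smooth_fun_on A W h"
    using assms unfolding smooth_near_def by blast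
  then show ?thesis by (intro that[of "V \<inter> W"]) (auto elim: smooth_fun_on_subset)
qed

lemma smooth_near_const: "smooth_near A p (\<lambda>_. c)"
  by (rule smooth_nearI[OF smooth_fun_on_const, of UNIV]) auto

lemma smooth_near_add: "smooth_near A p f \<Longrightarrow> smooth_near A p h \<Longrightarrow> smooth_near A p (f + h)"
  by (erule (1) smooth_near_combine) (auto intro: smooth_nearI smooth_fun_on_add)

lemma smooth_near_mult: "smooth_near A p f \<Longrightarrow> smooth_near A p h \<Longrightarrow> smooth_near A p (f * h)"
  by (erule (1) smooth_near_combine) (auto intro: smooth_nearI smooth_fun_on_mult)

lemma smooth_near_coordinate: "(U, x) \<in> A \<Longrightarrow> p \<in> U \<Longrightarrow> smooth_near A p (\<lambda>q. x q \<bullet> b)"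
  by (rule smooth_nearI[OF smooth_fun_on_coordinate]) (auto intro: chart_open)

lemma smooth_near_cong:
  assumes "open N" "p \<in> N" "\<And>q. q \<in> N \<Longrightarrow> f q = h q" "smooth_near A p f"
  shows "smooth_near A p h"
proof -
  obtain W where W: "open W" "p \<in> W" "smooth_fun_on A W f"
    using assms(4) unfolding smooth_near_def by blast
  show ?thesis
    by (rule smooth_nearI[OF smooth_fun_on_cong[OF smooth_fun_on_subset[OF W(3)], of "W \<inter> N"]])
      (use W assms in auto)
qed

lemma smooth_near_has_derivative:
  assumes c: "(U, x) \<in> A" and p: "p \<in> U" and f: "smooth_near A p f"
  shows "((f \<circ> inv_into U x) has_derivative frechet_derivative (f \<circ> inv_into U x) (at (x p))) (at (x p))"
proof -
  obtain W where W: "open W" "p \<in> W" "smooth_fun_on A W f"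
    using f unfolding smooth_near_def by blast
  have "Ck_on (Suc 0) (x ` (U \<inter> W)) (f \<circ> inv_into U x)"
    using smooth_fun_onD[OF W(3) c] by (simp add: o_def)
  then show ?thesis using p W(2) by (auto simp: frechet_derivative_works[symmetric])
qed

section \<open>Tangent vectors\<close>

lemma coord_vector_apply:
  "smooth_near A p f \<Longrightarrow>
    coord_vector A (U, x) p u f = frechet_derivative (f \<circ> inv_into U x) (at (x p)) u"
  by (simp add: coord_vector_def)

lemma coord_vector_undefined: "\<not> smooth_near A p f \<Longrightarrow> coord_vector A c p u f = 0"
  by (simp add: coord_vector_def split: prod.splits)

lemma coord_vector_change_chart:
  assumes c: "(U, x) \<in> A" "p \<in> U" and d: "(W, y) \<in> A" "p \<in> W"
  shows "coord_vector A (W, y) p u =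
    coord_vector A (U, x) p (frechet_derivative (x \<circ> inv_into W y) (at (y p)) u)"
proof
  fix f
  show "coord_vector A (W, y) p u f =
    coord_vector A (U, x) p (frechet_derivative (x \<circ> inv_into W y) (at (y p)) u) f"
  proof (cases "smooth_near A p f")
    case True
    let ?t = "x \<circ> inv_into W y"
    have "Ck_on (Suc 0) (y ` (W \<inter> U)) ?t" by (rule chart_transition[OF d(1) c(1)])
    then have t: "(?t has_derivative frechet_derivative ?t (at (y p))) (at (y p))"
      using c d by (auto simp: frechet_derivative_works[symmetric])
    have txy: "?t (y p) = x p" using chart_inverse[OF d] by simp
    have f: "((f \<circ> inv_into U x) has_derivative frechet_derivative (f \<circ> inv_into U x) (at (?t (y p))))
        (at (?t (y p)))"
      unfolding txy by (rule smooth_near_has_derivative[OF c True])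
    have "((f \<circ> inv_into W y) has_derivative
        (frechet_derivative (f \<circ> inv_into U x) (at (?t (y p))) \<circ> frechet_derivative ?t (at (y p)))) (at (y p))"
    proof (rule has_derivative_transform_within_open[OF diff_chain_at[OF t f]])
      show "open (y ` (W \<inter> U))" by (rule chart_image_open[OF d(1) chart_open[OF c(1)]])
      show "y p \<in> y ` (W \<inter> U)" using c d by auto
      show "(f \<circ> inv_into U x \<circ> ?t) z = (f \<circ> inv_into W y) z" if "z \<in> y ` (W \<inter> U)" for z
        using that chart_inverse[OF d(1)] chart_inverse[OF c(1)] by auto
    qed
    from frechet_derivative_at[OF this] show ?thesis
      unfolding txy by (simp add: coord_vector_apply True) (metis comp_apply)
  qed (simp add: coord_vector_undefined)
qed

lemma tangent_space_chart:
  assumes "(U, x) \<in> A" "p \<in> U"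
  shows "tangent_space A p = range (coord_vector A (U, x) p)"
proof
  show "tangent_space A p \<subseteq> range (coord_vector A (U, x) p)"
    unfolding tangent_space_def using coord_vector_change_chart[OF assms] by auto
  show "range (coord_vector A (U, x) p) \<subseteq> tangent_space A p"
    unfolding tangent_space_def using assms by force
qed

lemma linear_coord_vector:
  assumes "(U, x) \<in> A" "p \<in> U"
  shows "linear (coord_vector A (U, x) p)"
proof (rule linearI; rule ext)
  fix u v :: 'e and r :: real and f :: "'m \<Rightarrow> real"
  note lin = has_derivative_linear[OF smooth_near_has_derivative[OF assms]]
  show "coord_vector A (U, x) p (u + v) f = (coord_vector A (U, x) p u + coord_vector A (U, x) p v) f"
    by (cases "smooth_near A p f") (simp_all add: coord_vector_apply coord_vector_undefined linear_add[OF lin])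
  show "coord_vector A (U, x) p (r *\<^sub>R u) f = (r *\<^sub>R coord_vector A (U, x) p u) f"
    by (cases "smooth_near A p f")
      (simp_all add: coord_vector_apply coord_vector_undefined linear_cmul[OF lin] scaleR_fun_def)
qed

lemma subspace_tangent_space: "subspace (tangent_space A p)"
proof -
  obtain U x where "(U, x) \<in> A" "p \<in> U" using chart_exists by blast
  then show ?thesis
    by (simp add: tangent_space_chart linear_subspace_image linear_coord_vector)
qed

lemma tangent_obtain:
  assumes "v \<in> tangent_space A p"
  obtains U x u where "(U, x) \<in> A" "p \<in> U" "v = coord_vector A (U, x) p u"
  using assms unfolding tangent_space_def by auto

lemma tangent_undefined: "v \<in> tangent_space A p \<Longrightarrow> \<not> smooth_near A p f \<Longrightarrow> v f = 0"
  by (erule tangent_obtain) (simp add: coord_vector_undefined)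

lemma tangent_add:
  assumes "v \<in> tangent_space A p" "smooth_near A p f" "smooth_near A p h"
  shows "v (f + h) = v f + v h"
  using assms(1)
proof (rule tangent_obtain)
  fix U x u assume c: "(U, x) \<in> A" "p \<in> U" and v: "v = coord_vector A (U, x) p u"
  have "(((f + h) \<circ> inv_into U x) has_derivative (\<lambda>u. frechet_derivative (f \<circ> inv_into U x) (at (x p)) u +
      frechet_derivative (h \<circ> inv_into U x) (at (x p)) u)) (at (x p))"
    using has_derivative_add[OF smooth_near_has_derivative[OF c assms(2)] smooth_near_has_derivative[OF c assms(3)]]
    by (simp add: o_def)
  from frechet_derivative_at[OF this, symmetric] show ?thesis
    by (simp add: v coord_vector_apply assms smooth_near_add)
qed

lemma tangent_mult:
  assumes "v \<in> tangent_space A p" "smooth_near A p f" "smooth_near A p h"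
  shows "v (f * h) = f p * v h + v f * h p"
  using assms(1)
proof (rule tangent_obtain)
  fix U x u assume c: "(U, x) \<in> A" "p \<in> U" and v: "v = coord_vector A (U, x) p u"
  have "(((f * h) \<circ> inv_into U x) has_derivative (\<lambda>u. f p * frechet_derivative (h \<circ> inv_into U x) (at (x p)) u +
      frechet_derivative (f \<circ> inv_into U x) (at (x p)) u * h p)) (at (x p))"
    using has_derivative_mult[OF smooth_near_has_derivative[OF c assms(2)] smooth_near_has_derivative[OF c assms(3)]]
    by (simp add: o_def chart_inverse[OF c])
  from frechet_derivative_at[OF this, symmetric] show ?thesis
    by (simp add: v coord_vector_apply assms smooth_near_mult)
qed

lemma tangent_const:
  assumes "v \<in> tangent_space A p"
  shows "v (\<lambda>_. c) = 0"
  using assms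
  by (rule tangent_obtain) (simp add: coord_vector_apply smooth_near_const o_def)

lemma tangent_cong:
  assumes v: "v \<in> tangent_space A p" and N: "open N" "p \<in> N" "\<And>q. q \<in> N \<Longrightarrow> f q = h q"
  shows "v f = v h"
proof (cases "smooth_near A p f")
  case True
  then have h: "smooth_near A p h" using smooth_near_cong[OF N(1,2), of f h] N(3) by blast
  from v show ?thesis
  proof (rule tangent_obtain)
    fix U x u assume c: "(U, x) \<in> A" "p \<in> U" and v: "v = coord_vector A (U, x) p u"
    have "((h \<circ> inv_into U x) has_derivative frechet_derivative (f \<circ> inv_into U x) (at (x p))) (at (x p))"
      by (rule has_derivative_transform_within_open[OF smooth_near_has_derivative[OF c True]
            chart_image_open[OF c(1) N(1)]]) (use c N chart_inverse[OF c(1)] in auto)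
    from frechet_derivative_at[OF this] show ?thesis
      by (simp add: v coord_vector_apply True h)
  qed
next
  case False
  then have "\<not> smooth_near A p h" using smooth_near_cong[OF N(1,2), of h f] N(3) by metis
  with False show ?thesis using tangent_undefined[OF v] by simp
qed

lemma tangent_cmult:
  assumes "v \<in> tangent_space A p" "smooth_near A p f"
  shows "v ((\<lambda>_. c) * f) = c * v f"
  using tangent_mult[OF assms(1) smooth_near_const assms(2)] tangent_const[OF assms(1)] by simp

lemma tangent_diff:
  assumes "v \<in> tangent_space A p" "smooth_near A p f" "smooth_near A p h"
  shows "v (f - h) = v f - v h"
proof -
  have eq: "f - h = f + (\<lambda>_. -1) * h" by (simp add: fun_eq_iff)
  show ?thesis
    unfolding eq using tangent_add[OF assms(1,2) smooth_near_mult[OF smooth_near_const assms(3)]]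
      tangent_cmult[OF assms(1,3), of "-1"] by simp
qed

lemma tangent_sum:
  assumes v: "v \<in> tangent_space A p" and "finite I" "\<And>i. i \<in> I \<Longrightarrow> smooth_near A p (f i)"
  shows "v (sum f I) = (\<Sum>i\<in>I. v (f i)) \<and> smooth_near A p (sum f I)"
  using assms(2,3)
proof (induction I rule: finite_induct)
  case empty
  then show ?case using tangent_const[OF v, of 0] smooth_near_const[of p 0] by (simp add: zero_fun_def)
qed (simp add: tangent_add[OF v] smooth_near_add)

lemma coord_vector_coordinate:
  assumes "(U, x) \<in> A" "p \<in> U"
  shows "coord_vector A (U, x) p u (\<lambda>q. x q \<bullet> b) = u \<bullet> b"
proof -
  have "(((\<lambda>q. x q \<bullet> b) \<circ> inv_into U x) has_derivative (\<lambda>u. u \<bullet> b)) (at (x p))"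
  proof (rule has_derivative_transform_within_open[where f = "\<lambda>z. z \<bullet> b"])
    show "open (x ` U)" by (rule chart_image_open_subset[OF assms(1) chart_open[OF assms(1)]]) simp
    show "((\<lambda>z. z \<bullet> b) has_derivative (\<lambda>u. u \<bullet> b)) (at (x p))" by (auto intro!: derivative_eq_intros)
  qed (use assms chart_inverse[OF assms(1)] in auto)
  from frechet_derivative_at[OF this, symmetric] show ?thesis
    by (simp add: coord_vector_apply smooth_near_coordinate[OF assms])
qed

text \<open>The coordinates of a tangent vector are its values on the coordinate functions; these are only
  smooth near \<open>p\<close>, which is all that a tangent vector sees.\<close>

lemma tangent_expand:
  assumes c: "(U, x) \<in> A" "p \<in> U" and v: "v \<in> tangent_space A p"
  shows "v = (\<Sum>b\<in>Basis. v (\<lambda>q. x q \<bullet> b) *\<^sub>R coord_vector A (U, x) p b)"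
proof -
  note lin = linear_coord_vector[OF c]
  obtain u where u: "v = coord_vector A (U, x) p u" using v tangent_space_chart[OF c] by auto
  have "coord_vector A (U, x) p u = coord_vector A (U, x) p (\<Sum>b\<in>Basis. (u \<bullet> b) *\<^sub>R b)"
    by (simp add: euclidean_representation)
  also have "\<dots> = (\<Sum>b\<in>Basis. (u \<bullet> b) *\<^sub>R coord_vector A (U, x) p b)"
    by (simp add: linear_sum[OF lin] linear_cmul[OF lin])
  also have "\<dots> = (\<Sum>b\<in>Basis. v (\<lambda>q. x q \<bullet> b) *\<^sub>R coord_vector A (U, x) p b)"
    by (simp add: u coord_vector_coordinate[OF c])
  finally show ?thesis unfolding u .
qed

end

section \<open>Vector fields, bump functions and coordinate frames\<close>

lemma sum_fun_apply: "sum f I x = (\<Sum>i\<in>I. f i x)" for f :: "'i \<Rightarrow> 'a \<Rightarrow> 'b::comm_monoid_add"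
  by (induction I rule: infinite_finite_induct) auto

lemma fscale_simps:
  "fscale f (X + Y) = fscale f X + fscale f Y"
  "fscale f (X - Y) = fscale f X - fscale f Y"
  "fscale f (- X) = - fscale f X"
  "fscale f 0 = 0"
  "fscale (f + h) X = fscale f X + fscale h X"
  "fscale (f - h) X = fscale f X - fscale h X"
  "fscale (- f) X = - fscale f X"
  "fscale 0 X = 0"
  "fscale 1 X = X"
  "fscale f (fscale h X) = fscale (f * h) X"
  by (simp_all add: fscale_def fun_eq_iff scaleR_fun_def algebra_simps)

context manifold
begin

lemma field_tangent: "X \<in> fields A \<Longrightarrow> X p \<in> tangent_space A p"
  unfolding fields_def by blast

lemma smooth_fun_on_appl:
  "X \<in> fields A \<Longrightarrow> open W \<Longrightarrow> smooth_fun_on A W f \<Longrightarrow> smooth_fun_on A W (appl X f)"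
  unfolding fields_def by blast

lemma smooth_near_appl: "X \<in> fields A \<Longrightarrow> smooth_near A p f \<Longrightarrow> smooth_near A p (appl X f)"
  unfolding smooth_near_def using smooth_fun_on_appl by blast

lemma fieldsI:
  assumes "\<And>p. X p \<in> tangent_space A p"
    and "\<And>p. \<exists>N. open N \<and> p \<in> N \<and>
      (\<forall>W f. open W \<longrightarrow> W \<subseteq> N \<longrightarrow> smooth_fun_on A W f \<longrightarrow> smooth_fun_on A W (appl X f))"
  shows "X \<in> fields A"
  unfolding fields_def
proof (intro CollectI conjI allI impI assms(1))
  fix W f assume W: "open W" "smooth_fun_on A W f"
  show "smooth_fun_on A W (appl X f)"
  proof (rule smooth_fun_on_localI)
    fix p assume "p \<in> W"
    obtain N where N: "open N" "p \<in> N"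
      "\<forall>W f. open W \<longrightarrow> W \<subseteq> N \<longrightarrow> smooth_fun_on A W f \<longrightarrow> smooth_fun_on A W (appl X f)"
      using assms(2) by blast
    have "smooth_fun_on A (W \<inter> N) (appl X f)"
      using N(3) W N(1) smooth_fun_on_subset[OF W(2), of "W \<inter> N"] by blast
    then show "\<exists>N. open N \<and> p \<in> N \<and> smooth_fun_on A N (appl X f)"
      using \<open>p \<in> W\<close> W N by blast
  qed
qed

lemma appl_field_simps [simp]:
  "appl (X + Y) f = appl X f + appl Y f" "appl (X - Y) f = appl X f - appl Y f"
  "appl (- X) f = - appl X f" "appl 0 f = 0" "appl (fscale h X) f = h * appl X f"
  by (simp_all add: appl_def fun_eq_iff fscale_def scaleR_fun_def)

lemma fields_add [simp, intro]: "X \<in> fields A \<Longrightarrow> Y \<in> fields A \<Longrightarrow> X + Y \<in> fields A"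
proof (rule fieldsI)
  assume XY: "X \<in> fields A" "Y \<in> fields A"
  show "(X + Y) p \<in> tangent_space A p" for p
    using subspace_add[OF subspace_tangent_space] field_tangent XY by simp
  show "\<exists>N. open N \<and> p \<in> N \<and> (\<forall>W f. open W \<longrightarrow> W \<subseteq> N \<longrightarrow> smooth_fun_on A W f \<longrightarrow>
      smooth_fun_on A W (appl (X + Y) f))" for p
    using XY by (intro exI[of _ UNIV]) (simp add: smooth_fun_on_add smooth_fun_on_appl)
qed

lemma fields_fscale [simp, intro]:
  "X \<in> fields A \<Longrightarrow> smooth_fun_on A UNIV h \<Longrightarrow> fscale h X \<in> fields A"
proof (rule fieldsI)
  assume X: "X \<in> fields A" and h: "smooth_fun_on A UNIV h"
  show "fscale h X p \<in> tangent_space A p" for p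
    using subspace_scale[OF subspace_tangent_space] field_tangent X by (simp add: fscale_def)
  show "\<exists>N. open N \<and> p \<in> N \<and> (\<forall>W f. open W \<longrightarrow> W \<subseteq> N \<longrightarrow> smooth_fun_on A W f \<longrightarrow>
      smooth_fun_on A W (appl (fscale h X) f))" for p
    using X smooth_fun_on_subset[OF h subset_UNIV]
    by (intro exI[of _ UNIV]) (simp add: smooth_fun_on_mult smooth_fun_on_appl)
qed

lemma fields_zero [simp, intro]: "0 \<in> fields A"
proof (rule fieldsI)
  show "0 p \<in> tangent_space A p" for p using subspace_0[OF subspace_tangent_space] by simp
  have "smooth_fun_on A W 0" if "open W" for W
    using smooth_fun_on_const[OF that, of 0] by (simp add: zero_fun_def)
  then show "\<exists>N. open N \<and> p \<in> N \<and>
      (\<forall>W f. open W \<longrightarrow> W \<subseteq> N \<longrightarrow> smooth_fun_on A W f \<longrightarrow> smooth_fun_on A W (appl 0 f))" for p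
    by auto
qed

lemma fields_uminus [simp, intro]:
  assumes "X \<in> fields A" shows "- X \<in> fields A"
proof -
  have "- X = fscale (\<lambda>_. -1) X" by (simp add: fun_eq_iff fscale_def scaleR_fun_def)
  then show ?thesis using fields_fscale[OF assms smooth_fun_on_const, of "-1"] by simp
qed

lemma fields_diff [simp, intro]: "X \<in> fields A \<Longrightarrow> Y \<in> fields A \<Longrightarrow> X - Y \<in> fields A"
  using fields_add[of X "- Y"] fields_uminus[of Y] by simp

lemma fields_sum [intro]:
  "finite I \<Longrightarrow> (\<And>i. i \<in> I \<Longrightarrow> X i \<in> fields A) \<Longrightarrow> sum X I \<in> fields A"
  by (induction I rule: finite_induct) auto

text \<open>The Hausdorff property enters here: a closed ball in a chart image is compact, so its
  preimage is closed in the whole manifold and a bump function extends by zero.\<close>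

lemma bump_function_exists:
  assumes "open W" "p \<in> W"
  obtains \<psi> C N where "smooth_fun_on A UNIV \<psi>" "closed C" "C \<subseteq> W" "open N" "p \<in> N"
    "\<And>q. q \<in> N \<Longrightarrow> \<psi> q = 1" "\<And>q. q \<notin> C \<Longrightarrow> \<psi> q = (0::real)"
proof -
  obtain U x where c: "(U, x) \<in> A" "p \<in> U" using chart_exists by blast
  have "open (x ` (U \<inter> W))" by (rule chart_image_open[OF c(1) assms(1)])
  moreover have "x p \<in> x ` (U \<inter> W)" using c assms by auto
  ultimately obtain r where r: "r > 0" "cball (x p) r \<subseteq> x ` (U \<inter> W)"
    using open_contains_cball by blast
  obtain f :: "'e \<Rightarrow> real" and \<delta> where f: "\<And>k. Ck_on k UNIV f" "\<delta> > 0" "\<delta> \<le> r"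
    "\<And>z. dist (x p) z < \<delta> \<Longrightarrow> f z = 1" "\<And>z. dist (x p) z > r \<Longrightarrow> f z = 0"
    using bump_exists[OF r(1), of "x p"] by blast
  let ?C = "inv_into U x ` cball (x p) r"
  let ?N = "{q \<in> U. x q \<in> ball (x p) \<delta>}"
  let ?\<psi> = "\<lambda>q. if q \<in> U then f (x q) else 0"
  have "compact ?C"
    by (rule compact_continuous_image[OF continuous_on_subset[OF chart_inverse_continuous[OF c(1)]]])
      (use r in auto)
  then have C: "closed ?C" by (rule compact_imp_closed)
  have CW: "?C \<subseteq> U \<inter> W"
  proof
    fix q assume "q \<in> ?C"
    then obtain q' where "q' \<in> U \<inter> W" "q = inv_into U x (x q')" using r(2) by blast
    then show "q \<in> U \<inter> W" using chart_inverse[OF c(1)] by auto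
  qed
  have inC: "q \<in> ?C" if "q \<in> U" "dist (x p) (x q) \<le> r" for q
    using that chart_inverse[OF c(1) that(1)] by (metis image_eqI mem_cball)
  have off: "?\<psi> q = 0" if "q \<notin> ?C" for q
    using inC[of q] that f(5)[of "x q"] by (cases "q \<in> U") force+
  have N: "open ?N"
  proof -
    have "?N = U \<inter> x -` ball (x p) \<delta>" by auto
    then show ?thesis
      using continuous_open_preimage[OF chart_continuous[OF c(1)] chart_open[OF c(1)] open_ball] by simp
  qed
  have smoothU: "smooth_fun_on A U ?\<psi>"
  proof (rule smooth_fun_on_chartI[OF c(1) chart_open[OF c(1)] order_refl])
    show "Ck_on k (x ` U) (\<lambda>z. ?\<psi> (inv_into U x z))" for k
      by (rule Ck_on_cong[OF chart_image_open_subset[OF c(1) chart_open[OF c(1)] order_refl]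
            Ck_on_subset[OF f(1) subset_UNIV]])
        (auto simp: chart_inverse[OF c(1)])
  qed
  have smooth: "smooth_fun_on A UNIV ?\<psi>"
  proof (rule smooth_fun_on_localI)
    fix q
    show "\<exists>N. open N \<and> q \<in> N \<and> smooth_fun_on A N ?\<psi>"
    proof (cases "q \<in> U")
      case True
      then show ?thesis using smoothU chart_open[OF c(1)] by blast
    next
      case False
      have "smooth_fun_on A (- ?C) ?\<psi>"
        by (rule smooth_fun_on_cong[OF smooth_fun_on_const[of _ 0]]) (use C off in auto)
      then show ?thesis using False C CW by (intro exI[of _ "- ?C"]) auto
    qed
  qed
  show ?thesis
    by (rule that[OF smooth C _ N _ _ off]) (use c f CW in auto)
qed

lemma smooth_extend_by_zero:
  assumes "smooth_fun_on A UNIV \<psi>" "closed C" "C \<subseteq> W" "open W" "\<And>q. q \<notin> C \<Longrightarrow> \<psi> q = 0"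
    "smooth_fun_on A W f"
  shows "smooth_fun_on A UNIV (\<psi> * f)"
proof (rule smooth_fun_on_localI)
  fix p
  show "\<exists>N. open N \<and> p \<in> N \<and> smooth_fun_on A N (\<psi> * f)"
  proof (cases "p \<in> W")
    case True
    have "smooth_fun_on A W (\<psi> * f)"
      using assms smooth_fun_on_subset[OF assms(1), of W] by (auto intro: smooth_fun_on_mult)
    then show ?thesis using True assms(4) by blast
  next
    case False
    have "smooth_fun_on A (- C) (\<psi> * f)"
      by (rule smooth_fun_on_cong[OF smooth_fun_on_const[of _ 0]]) (use assms in auto)
    then show ?thesis using False assms(2,3) by (intro exI[of _ "- C"]) auto
  qed
qed

lemma smooth_fun_on_coord_vector:
  assumes c: "(U, x) \<in> A" and W: "open W" "W \<subseteq> U" and f: "smooth_fun_on A W f"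
  shows "smooth_fun_on A W (\<lambda>q. coord_vector A (U, x) q u f)"
proof (rule smooth_fun_on_chartI[OF c W])
  fix k
  let ?D = "\<lambda>z. frechet_derivative (\<lambda>z. f (inv_into U x z)) (at z) u"
  have WU: "U \<inter> W = W" using W by auto
  have "Ck_on (Suc k) (x ` W) (\<lambda>z. f (inv_into U x z))"
    using smooth_fun_onD[OF f c] unfolding WU .
  then have "Ck_on k (x ` W) ?D" by simp
  then show "Ck_on k (x ` W) (\<lambda>z. coord_vector A (U, x) (inv_into U x z) u f)"
  proof (rule Ck_on_cong[OF chart_image_open_subset[OF c W]])
    fix z assume "z \<in> x ` W"
    then obtain q where q: "q \<in> W" "z = x q" by blast
    then have "q \<in> U" "smooth_near A q f" using W f smooth_nearI by blast+
    then show "?D z = coord_vector A (U, x) (inv_into U x z) u f"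
      by (simp add: q chart_inverse[OF c] coord_vector_apply o_def)
  qed
qed

definition coordinate_frame :: "'m set \<Rightarrow> ('m \<Rightarrow> 'e) \<Rightarrow> 'm set \<Rightarrow> ('e \<Rightarrow> 'm field) \<Rightarrow> bool" where
  "coordinate_frame U x N E \<longleftrightarrow> (U, x) \<in> A \<and> open N \<and> N \<subseteq> U \<and> (\<forall>b. E b \<in> fields A) \<and>
     (\<forall>b. \<forall>q\<in>N. E b q = coord_vector A (U, x) q b)"

text \<open>Coordinate fields, cut off by a bump function, are global vector fields.\<close>

lemma coordinate_frame_exists: "\<exists>U x N E. p \<in> N \<and> coordinate_frame U x N E"
proof -
  obtain U x where c: "(U, x) \<in> A" "p \<in> U" using chart_exists by blast
  obtain \<psi> C N where \<psi>: "smooth_fun_on A UNIV \<psi>" "closed C" "C \<subseteq> U" "open N" "p \<in> N"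
    "\<And>q. q \<in> N \<Longrightarrow> \<psi> q = 1" "\<And>q. q \<notin> C \<Longrightarrow> \<psi> q = (0::real)"
    using bump_function_exists[OF chart_open[OF c(1)] c(2)] by blast
  let ?E = "\<lambda>b q. if q \<in> U then \<psi> q *\<^sub>R coord_vector A (U, x) q b else 0"
  have "?E b \<in> fields A" for b
  proof (rule fieldsI)
    show "?E b q \<in> tangent_space A q" for q
    proof (cases "q \<in> U")
      case True
      then have "coord_vector A (U, x) q b \<in> tangent_space A q" using tangent_space_chart[OF c(1)] by simp
      then show ?thesis using True subspace_scale[OF subspace_tangent_space] by simp
    qed (simp add: subspace_0[OF subspace_tangent_space])
    fix q
    show "\<exists>N. open N \<and> q \<in> N \<and>
      (\<forall>W f. open W \<longrightarrow> W \<subseteq> N \<longrightarrow> smooth_fun_on A W f \<longrightarrow> smooth_fun_on A W (appl (?E b) f))"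
    proof (cases "q \<in> U")
      case True
      have "smooth_fun_on A W (appl (?E b) f)"
        if W: "open W" "W \<subseteq> U" "smooth_fun_on A W f" for W f
      proof (rule smooth_fun_on_cong)
        show "smooth_fun_on A W (\<psi> * (\<lambda>q. coord_vector A (U, x) q b f))"
          by (intro smooth_fun_on_mult smooth_fun_on_coord_vector c W
              smooth_fun_on_subset[OF \<psi>(1)]) auto
      qed (use W in \<open>auto simp: appl_def scaleR_fun_def\<close>)
      then show ?thesis using True chart_open[OF c(1)] by blast
    next
      case False
      have "smooth_fun_on A W (appl (?E b) f)" if W: "open W" "W \<subseteq> - C" for W f
        by (rule smooth_fun_on_cong[OF smooth_fun_on_const[of _ 0]])
          (use W \<psi>(7) in \<open>auto simp: appl_def\<close>)
      then show ?thesis using False \<psi> by (intro exI[of _ "- C"]) auto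
    qed
  qed
  moreover have "?E b q = coord_vector A (U, x) q b" if "q \<in> N \<inter> U" for b q
    using that \<psi>(6) by auto
  ultimately show ?thesis
    unfolding coordinate_frame_def using \<psi>(4,5) c chart_open[OF c(1)]
    by (intro exI[of _ U] exI[of _ x] exI[of _ "N \<inter> U"] exI[of _ ?E]) auto
qed

lemma coordinate_frameD:
  assumes "coordinate_frame U x N E"
  shows "(U, x) \<in> A" "open N" "N \<subseteq> U" "\<And>b. E b \<in> fields A"
    "\<And>b q. q \<in> N \<Longrightarrow> E b q = coord_vector A (U, x) q b"
  using assms unfolding coordinate_frame_def by blast+

lemma field_extension:
  assumes v: "v \<in> tangent_space A p"
  shows "\<exists>X\<in>fields A. X p = v"
proof -
  obtain U x N E where p: "p \<in> N" and E: "coordinate_frame U x N E"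
    using coordinate_frame_exists by blast
  note E = coordinate_frameD[OF E]
  have "p \<in> U" using p E(3) by blast
  then obtain u where "v = coord_vector A (U, x) p u" using v tangent_space_chart[OF E(1)] by auto
  then show ?thesis using E(4)[of u] E(5)[OF p, of u] by metis
qed

section \<open>Tensorial operators and their traces\<close>

text \<open>Linearity over smooth functions: these operators are the endomorphism fields of the tangent
  bundle.\<close>

definition tensorial :: "('m field \<Rightarrow> 'm field) \<Rightarrow> bool" where
  "tensorial L \<longleftrightarrow> (\<forall>X\<in>fields A. L X \<in> fields A) \<and>
     (\<forall>X\<in>fields A. \<forall>Y\<in>fields A. L (X + Y) = L X + L Y) \<and>
     (\<forall>X\<in>fields A. \<forall>f. smooth_fun_on A UNIV f \<longrightarrow> L (fscale f X) = fscale f (L X))"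

definition trace :: "('m field \<Rightarrow> 'm field) \<Rightarrow> 'm \<Rightarrow> real" where
  "trace L = (\<lambda>p. trace_on (tangent_space A p) (at_point A L p))"

lemma tensorial_sum:
  assumes L: "tensorial L" and "finite I" "\<And>i. i \<in> I \<Longrightarrow> X i \<in> fields A"
  shows "L (sum X I) = (\<Sum>i\<in>I. L (X i))"
  using assms(2,3)
proof (induction I rule: finite_induct)
  case empty
  have "L (0 + 0) = L 0 + L 0" using L fields_zero unfolding tensorial_def by blast
  then have "L 0 = 0" by simp
  then show ?case by (simp only: sum.empty)
next
  case (insert i I)
  then have "L (X i + sum X I) = L (X i) + L (sum X I)"
    using L fields_sum[of I X] unfolding tensorial_def by blast
  then show ?case using insert by (simp only: sum.insert insert_iff simp_thms)
qed

text \<open>The value of a tensorial operator at a point only depends on the argument at that point: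
  multiplying by a bump function makes the expansion in a coordinate frame global.\<close>

lemma tensorial_expand:
  assumes frame: "coordinate_frame U x N E"
    and L: "tensorial L" and X: "X \<in> fields A" and q: "q \<in> N"
  shows "L X q = (\<Sum>b\<in>Basis. X q (\<lambda>q. x q \<bullet> b) *\<^sub>R L (E b) q)"
proof -
  note c = coordinate_frameD(1)[OF frame] and N = coordinate_frameD(2,3)[OF frame]
    and E = coordinate_frameD(4,5)[OF frame]
  obtain \<psi> C M where \<psi>: "smooth_fun_on A UNIV \<psi>" "closed C" "C \<subseteq> N" "open M" "q \<in> M"
    "\<And>q. q \<in> M \<Longrightarrow> \<psi> q = 1" "\<And>q. q \<notin> C \<Longrightarrow> \<psi> q = (0::real)"
    using bump_function_exists[OF N(1) q] by blast
  let ?a = "\<lambda>b. \<psi> * appl X (\<lambda>q. x q \<bullet> b)"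
  have a: "smooth_fun_on A UNIV (?a b)" for b
    by (rule smooth_extend_by_zero[OF \<psi>(1-3) N(1) \<psi>(7)])
      (auto intro!: smooth_fun_on_appl X N smooth_fun_on_coordinate[OF c])
  have "fscale \<psi> X = (\<Sum>b\<in>Basis. fscale (?a b) (E b))"
  proof
    fix r
    show "fscale \<psi> X r = (\<Sum>b\<in>Basis. fscale (?a b) (E b)) r"
    proof (cases "r \<in> N")
      case True
      have "X r = (\<Sum>b\<in>Basis. X r (\<lambda>q. x q \<bullet> b) *\<^sub>R coord_vector A (U, x) r b)"
        using True N by (intro tangent_expand[OF c] field_tangent X) auto
      then have "fscale \<psi> X r = \<psi> r *\<^sub>R (\<Sum>b\<in>Basis. X r (\<lambda>q. x q \<bullet> b) *\<^sub>R coord_vector A (U, x) r b)"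
        by (metis fscale_def)
      also have "\<dots> = (\<Sum>b\<in>Basis. fscale (?a b) (E b) r)"
        by (simp add: fscale_def E(2)[OF True] appl_def scaleR_sum_right)
      finally show ?thesis by (simp only: sum_fun_apply)
    next
      case False
      then have "\<psi> r = 0" using \<psi>(3,7) by blast
      then show ?thesis by (simp add: fscale_def sum_fun_apply)
    qed
  qed
  then have "L (fscale \<psi> X) = L (\<Sum>b\<in>Basis. fscale (?a b) (E b))" by simp
  also have "\<dots> = (\<Sum>b\<in>Basis. L (fscale (?a b) (E b)))"
    by (rule tensorial_sum[OF L]) (auto intro!: a E)
  finally have "fscale \<psi> (L X) = (\<Sum>b\<in>Basis. fscale (?a b) (L (E b)))"
    using L X E(1) a \<psi>(1) unfolding tensorial_def by simp
  from fun_cong[OF this, of q] show ?thesis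
    using \<psi>(5,6) by (simp add: fscale_def appl_def sum_fun_apply)
qed

lemma tensorial_at_point:
  assumes L: "tensorial L" and "X \<in> fields A" "Y \<in> fields A" "X q = Y q"
  shows "L X q = L Y q"
proof -
  obtain U x N E where q: "q \<in> N" and E: "coordinate_frame U x N E"
    using coordinate_frame_exists by blast
  note expand = tensorial_expand[OF E L _ q]
  show ?thesis using expand[OF assms(2)] expand[OF assms(3)] assms(4) by simp
qed

lemma at_point_eq:
  assumes L: "tensorial L" and X: "X \<in> fields A"
  shows "at_point A L q (X q) = L X q"
proof -
  let ?Y = "SOME Y. Y \<in> fields A \<and> Y q = X q"
  have "?Y \<in> fields A \<and> ?Y q = X q" by (rule someI[of _ X]) (use X in auto)
  then show ?thesis unfolding at_point_def using tensorial_at_point[OF L _ X] by simp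
qed

end

text \<open>Expand each vector of the unknown basis in the family \<open>e\<close>, and exchange the two sums: the inner
  one reassembles \<open>L (e i)\<close> from its representation.\<close>

lemma trace_on_eq_sum:
  fixes S :: "'a::real_vector set" and e :: "'i \<Rightarrow> 'a" and \<theta> :: "'i \<Rightarrow> 'a \<Rightarrow> real"
  assumes S: "subspace S" and I: "finite I" and e: "\<And>i. i \<in> I \<Longrightarrow> e i \<in> S"
    and \<theta>: "\<And>i. i \<in> I \<Longrightarrow> lin_on S (\<theta> i)"
    and expand: "\<And>v. v \<in> S \<Longrightarrow> v = (\<Sum>i\<in>I. \<theta> i v *\<^sub>R e i)"
    and L: "\<And>v. v \<in> S \<Longrightarrow> L v = (\<Sum>i\<in>I. \<theta> i v *\<^sub>R L (e i))" "\<And>i. i \<in> I \<Longrightarrow> L (e i) \<in> S"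
  shows "trace_on S L = (\<Sum>i\<in>I. \<theta> i (L (e i)))"
proof -
  let ?B = "SOME B. B \<subseteq> S \<and> independent B \<and> span B = S"
  have "\<exists>B. B \<subseteq> S \<and> independent B \<and> span B = S"
  proof -
    obtain B where "B \<subseteq> S" "independent B" "S \<subseteq> span B"
      using maximal_independent_subset[of S] by blast
    then show ?thesis using span_minimal[OF _ S] by blast
  qed
  then have B: "?B \<subseteq> S" "independent ?B" "span ?B = S"
    by (metis (mono_tags, lifting) someI_ex)+
  define B where "B = ?B"
  note B = B[folded B_def]
  have "S \<subseteq> span (e ` I)"
  proof
    fix v assume "v \<in> S"
    then have "v = (\<Sum>i\<in>I. \<theta> i v *\<^sub>R e i)" by (rule expand)
    also have "\<dots> \<in> span (e ` I)" by (intro span_sum span_scale span_base) auto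
    finally show "v \<in> span (e ` I)" .
  qed
  then have fin: "finite B"
    using independent_span_bound[of "e ` I" B] I B by auto
  have \<theta>_sum: "\<theta> i (\<Sum>b\<in>T. f b *\<^sub>R b) = (\<Sum>b\<in>T. f b * \<theta> i b)"
    if i: "i \<in> I" and "finite T" "T \<subseteq> S" for i T and f :: "'a \<Rightarrow> real"
    using that(2,3)
  proof (induction T rule: finite_induct)
    case empty
    have "\<theta> i (0 *\<^sub>R 0) = 0 *\<^sub>R \<theta> i 0" using \<theta>[OF i] subspace_0[OF S] unfolding lin_on_def by blast
    then show ?case by simp
  next
    case (insert b T)
    have "(\<Sum>b\<in>T. f b *\<^sub>R b) \<in> S" "b \<in> S" "f b *\<^sub>R b \<in> S"
      using insert S by (auto intro!: subspace_sum subspace_scale)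
    then show ?case using insert \<theta>[OF i] unfolding lin_on_def by simp
  qed
  have rep_sum: "representation B (\<Sum>i\<in>I. c i *\<^sub>R L (e i)) b = (\<Sum>i\<in>I. c i * representation B (L (e i)) b)"
    for c b
  proof -
    have "L (e i) \<in> span B" if "i \<in> I" for i using L(2)[OF that] B by simp
    then show ?thesis
      by (subst representation_sum[OF B(2)])
        (auto simp: representation_scale[OF B(2)] intro: span_scale)
  qed
  have "trace_on S L = (\<Sum>b\<in>B. representation B (L b) b)"
    unfolding trace_on_def Let_def B_def ..
  also have "\<dots> = (\<Sum>b\<in>B. \<Sum>i\<in>I. \<theta> i b * representation B (L (e i)) b)"
  proof (rule sum.cong[OF refl])
    fix b assume "b \<in> B"
    then have "L b = (\<Sum>i\<in>I. \<theta> i b *\<^sub>R L (e i))" using L(1) B(1) by blast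
    then show "representation B (L b) b = (\<Sum>i\<in>I. \<theta> i b * representation B (L (e i)) b)"
      by (simp add: rep_sum)
  qed
  also have "\<dots> = (\<Sum>i\<in>I. \<Sum>b\<in>B. representation B (L (e i)) b * \<theta> i b)"
    by (subst sum.swap) (simp add: mult.commute)
  also have "\<dots> = (\<Sum>i\<in>I. \<theta> i (L (e i)))"
  proof (rule sum.cong[OF refl])
    fix i assume i: "i \<in> I"
    have "(\<Sum>b\<in>B. representation B (L (e i)) b *\<^sub>R b) = L (e i)"
      using sum_representation_eq[OF B(2) _ fin order_refl] L(2)[OF i] B(3) by simp
    then show "(\<Sum>b\<in>B. representation B (L (e i)) b * \<theta> i b) = \<theta> i (L (e i))"
      using \<theta>_sum[OF i fin B(1)] by metis
  qed
  finally show ?thesis .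
qed

context manifold
begin

lemma trace_coordinates:
  assumes frame: "coordinate_frame U x N E"
    and L: "tensorial L" and q: "q \<in> N"
  shows "trace L q = (\<Sum>b\<in>Basis. L (E b) q (\<lambda>q. x q \<bullet> b))"
proof -
  note c = coordinate_frameD(1)[OF frame] and N = coordinate_frameD(2,3)[OF frame]
    and E = coordinate_frameD(4,5)[OF frame]
  have qU: "q \<in> U" using q N by auto
  have LE: "L (E b) \<in> fields A" for b using L E(1) unfolding tensorial_def by blast
  have at: "at_point A L q (coord_vector A (U, x) q b) = L (E b) q" for b
    using at_point_eq[OF L E(1)] E(2)[OF q] by metis
  have "trace L q = (\<Sum>b\<in>Basis. at_point A L q (coord_vector A (U, x) q b) (\<lambda>q. x q \<bullet> b))"
    unfolding trace_def
  proof (rule trace_on_eq_sum[OF subspace_tangent_space finite_Basis])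
    fix b :: 'e assume b: "b \<in> Basis"
    show "coord_vector A (U, x) q b \<in> tangent_space A q"
      using tangent_space_chart[OF c qU] by auto
    show "at_point A L q (coord_vector A (U, x) q b) \<in> tangent_space A q"
      unfolding at by (rule field_tangent[OF LE])
    show "lin_on (tangent_space A q) (\<lambda>v. v (\<lambda>q. x q \<bullet> b))"
      by (simp add: lin_on_def scaleR_fun_def)
  next
    fix v assume v: "v \<in> tangent_space A q"
    show "v = (\<Sum>b\<in>Basis. v (\<lambda>q. x q \<bullet> b) *\<^sub>R coord_vector A (U, x) q b)"
      by (rule tangent_expand[OF c qU v])
    obtain X where X: "X \<in> fields A" "X q = v" using field_extension[OF v] by blast
    show "at_point A L q v = (\<Sum>b\<in>Basis. v (\<lambda>q. x q \<bullet> b) *\<^sub>R at_point A L q (coord_vector A (U, x) q b))"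
      unfolding at X(2)[symmetric] at_point_eq[OF L X(1)] by (rule tensorial_expand[OF frame L X(1) q])
  qed
  then show ?thesis unfolding at .
qed

lemma trace_add:
  assumes "tensorial L" "tensorial L'"
  shows "trace (\<lambda>X. L X + L' X) p = trace L p + trace L' p"
proof -
  obtain U x N E where p: "p \<in> N" and frame: "coordinate_frame U x N E"
    using coordinate_frame_exists by blast
  note f = coordinate_frameD[OF frame]
  have t: "tensorial (\<lambda>X. L X + L' X)"
    using assms unfolding tensorial_def by (auto simp: fscale_simps mult.commute)
  note tr = trace_coordinates[OF frame _ p]
  show ?thesis by (simp add: tr assms t sum.distrib)
qed

lemma trace_fscale:
  assumes "tensorial L" "smooth_fun_on A UNIV h"
  shows "trace (\<lambda>X. fscale h (L X)) p = h p * trace L p"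
proof -
  obtain U x N E where p: "p \<in> N" and frame: "coordinate_frame U x N E"
    using coordinate_frame_exists by blast
  note f = coordinate_frameD[OF frame]
  have t: "tensorial (\<lambda>X. fscale h (L X))"
    using assms unfolding tensorial_def by (auto simp: fscale_simps mult.commute)
  note tr = trace_coordinates[OF frame _ p]
  show ?thesis unfolding tr[OF t] tr[OF assms(1)]
    by (simp add: fscale_def scaleR_fun_def sum_distrib_left)
qed

lemma trace_id: "trace (\<lambda>X. X) p = DIM('e)"
proof -
  obtain U x N E where p: "p \<in> N" and frame: "coordinate_frame U x N E"
    using coordinate_frame_exists by blast
  note f = coordinate_frameD[OF frame]
  have t: "tensorial (\<lambda>X. X)" unfolding tensorial_def by auto
  have "p \<in> U" using f(3) p by blast
  then show ?thesis
    by (simp add: trace_coordinates[OF frame t p] f(5)[OF p] coord_vector_coordinate[OF f(1)])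
qed

lemma trace_rank_one:
  assumes Y: "Y \<in> fields A" and \<alpha>: "\<And>X. X \<in> fields A \<Longrightarrow> smooth_fun_on A UNIV (\<alpha> X)"
    "\<And>X X'. X \<in> fields A \<Longrightarrow> X' \<in> fields A \<Longrightarrow> \<alpha> (X + X') = \<alpha> X + \<alpha> X'"
    "\<And>X f. X \<in> fields A \<Longrightarrow> smooth_fun_on A UNIV f \<Longrightarrow> \<alpha> (fscale f X) = f * \<alpha> X"
  shows "trace (\<lambda>X. fscale (\<alpha> X) Y) p = \<alpha> Y p" and "tensorial (\<lambda>X. fscale (\<alpha> X) Y)"
proof -
  obtain U x N E where p: "p \<in> N" and frame: "coordinate_frame U x N E"
    using coordinate_frame_exists by blast
  note f = coordinate_frameD[OF frame]
  have ten: "tensorial (\<lambda>X. fscale (\<alpha> X) Z)" if "Z \<in> fields A" for Z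
    unfolding tensorial_def using that \<alpha> by (auto simp: fscale_simps)
  then show t: "tensorial (\<lambda>X. fscale (\<alpha> X) Y)" using Y by blast
  have pU: "p \<in> U" using f(3) p by blast
  show "trace (\<lambda>X. fscale (\<alpha> X) Y) p = \<alpha> Y p"
  proof -
    \<comment> \<open>The expansion of \<open>\<alpha>(Y)\<close> in the frame is read off from the operator \<open>X \<mapsto> \<alpha>(X) (E b)\<close>.\<close>
    obtain b0 :: 'e where b0: "b0 \<in> Basis" using nonempty_Basis by blast
    have "fscale (\<alpha> Y) (E b0) p (\<lambda>q. x q \<bullet> b0) =
        (\<Sum>b\<in>Basis. Y p (\<lambda>q. x q \<bullet> b) *\<^sub>R fscale (\<alpha> (E b)) (E b0) p) (\<lambda>q. x q \<bullet> b0)"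
      using tensorial_expand[OF frame ten[OF f(4)] Y p] by simp
    then have "\<alpha> Y p = (\<Sum>b\<in>Basis. Y p (\<lambda>q. x q \<bullet> b) * \<alpha> (E b) p)"
      using b0 by (simp add: fscale_def f(5)[OF p] scaleR_fun_def coord_vector_coordinate[OF f(1) pU] sum_fun_apply)
    moreover have "trace (\<lambda>X. fscale (\<alpha> X) Y) p = (\<Sum>b\<in>Basis. \<alpha> (E b) p * Y p (\<lambda>q. x q \<bullet> b))"
      unfolding trace_coordinates[OF frame t p] by (simp add: fscale_def scaleR_fun_def)
    ultimately show ?thesis by (simp add: mult.commute)
  qed
qed

end

section \<open>Lie brackets and the derivative of a trace\<close>

context manifold
begin

lemma smooth_near_global: "smooth_fun_on A UNIV f \<Longrightarrow> smooth_near A p f"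
  by (rule smooth_nearI) auto

lemma bracket_apply:
  "smooth_near A p f \<Longrightarrow> bracket A X Y p f = X p (appl Y f) - Y p (appl X f)"
  by (simp add: bracket_def appl_def)

lemma bracket_undefined: "\<not> smooth_near A p f \<Longrightarrow> bracket A X Y p f = 0"
  by (simp add: bracket_def)

lemma tangent_appl_bracket:
  assumes "v \<in> tangent_space A p" "X \<in> fields A" "Y \<in> fields A" "smooth_near A p f"
  shows "v (appl (bracket A X Y) f) = v (appl X (appl Y f)) - v (appl Y (appl X f))"
proof -
  obtain W where W: "open W" "p \<in> W" "smooth_fun_on A W f"
    using assms(4) unfolding smooth_near_def by blast
  have "v (appl (bracket A X Y) f) = v (appl X (appl Y f) - appl Y (appl X f))"
  proof (rule tangent_cong[OF assms(1) W(1,2)])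
    fix q assume "q \<in> W"
    then have "smooth_near A q f" using W smooth_nearI by blast
    then show "appl (bracket A X Y) f q = (appl X (appl Y f) - appl Y (appl X f)) q"
      by (simp add: bracket_apply appl_def)
  qed
  then show ?thesis using assms by (simp add: tangent_diff smooth_near_appl)
qed

lemma bracket_jacobi:
  assumes X: "X \<in> fields A" and Y: "Y \<in> fields A" and Z: "Z \<in> fields A"
  shows "bracket A X (bracket A Y Z) = bracket A (bracket A X Y) Z + bracket A Y (bracket A X Z)"
proof (rule ext, rule ext)
  fix p f
  show "bracket A X (bracket A Y Z) p f =
    (bracket A (bracket A X Y) Z + bracket A Y (bracket A X Z)) p f"
  proof (cases "smooth_near A p f")
    case True
    note t = field_tangent[OF X, of p] field_tangent[OF Y, of p] field_tangent[OF Z, of p]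
    show ?thesis
      using assms t True by (simp add: bracket_apply tangent_appl_bracket smooth_near_appl)
  qed (simp add: bracket_undefined)
qed

text \<open>In a coordinate frame \<open>E b\<close> of \<open>x\<close> the trace of \<open>L\<close> is the sum of \<open>L (E b) (x b)\<close>.
  Differentiating along \<open>\<xi>\<close>, the two correction terms cancel, being the traces of \<open>L P\<close> and \<open>P L\<close>
  for the matrix \<open>P\<close> of the coordinate derivatives of \<open>\<xi>\<close>.\<close>

lemma appl_trace:
  assumes \<xi>: "\<xi> \<in> fields A" and br: "\<And>X. X \<in> fields A \<Longrightarrow> bracket A \<xi> X \<in> fields A"
    and L: "tensorial L" and L': "tensorial (\<lambda>X. bracket A \<xi> (L X) - L (bracket A \<xi> X))"
  shows "appl \<xi> (trace L) p = trace (\<lambda>X. bracket A \<xi> (L X) - L (bracket A \<xi> X)) p"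
proof -
  obtain U x N E where p: "p \<in> N" and frame: "coordinate_frame U x N E"
    using coordinate_frame_exists by blast
  note f = coordinate_frameD[OF frame]
  have pU: "p \<in> U" using p f(3) by blast
  let ?x = "\<lambda>b q. x q \<bullet> b"
  have LE: "L (E b) \<in> fields A" for b using L f(4) unfolding tensorial_def by blast
  have xs: "smooth_near A p (?x b)" for b by (rule smooth_near_coordinate[OF f(1) pU])
  note tE = field_tangent[OF f(4)] and tL = field_tangent[OF LE] and t\<xi> = field_tangent[OF \<xi>]
  have "appl \<xi> (trace L) p = \<xi> p (\<Sum>b\<in>Basis. appl (L (E b)) (?x b))"
    unfolding appl_def[of \<xi>]
    by (rule tangent_cong[OF t\<xi> f(2) p])
      (simp add: trace_coordinates[OF frame L] sum_fun_apply appl_def)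
  also have "\<dots> = (\<Sum>b\<in>Basis. \<xi> p (appl (L (E b)) (?x b)))"
    by (rule tangent_sum[OF t\<xi> finite_Basis, THEN conjunct1]) (rule smooth_near_appl[OF LE xs])
  finally have lhs: "appl \<xi> (trace L) p = (\<Sum>b\<in>Basis. \<xi> p (appl (L (E b)) (?x b)))" .
  let ?M = "\<lambda>b c. L (E b) p (?x c)"
  have LE_apply: "L (E b) p h = (\<Sum>c\<in>Basis. ?M b c * E c p h)" for b h
  proof -
    have "L (E b) p = (\<Sum>c\<in>Basis. ?M b c *\<^sub>R coord_vector A (U, x) p c)"
      by (rule tangent_expand[OF f(1) pU tL])
    from fun_cong[OF this, of h] show ?thesis
      by (simp add: sum_fun_apply scaleR_fun_def f(5)[OF p])
  qed
  have br_coord: "bracket A \<xi> (E b) p (?x c) = - E b p (appl \<xi> (?x c))" for b c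
  proof -
    have "\<xi> p (appl (E b) (?x c)) = \<xi> p (\<lambda>_. b \<bullet> c)"
      by (rule tangent_cong[OF t\<xi> f(2) p])
        (use f(3) in \<open>auto simp: appl_def f(5) coord_vector_coordinate[OF f(1)]\<close>)
    then show ?thesis by (simp add: bracket_apply[OF xs] tangent_const[OF t\<xi>])
  qed
  have L_br: "L (bracket A \<xi> (E b)) p (?x b) = - (\<Sum>c\<in>Basis. E b p (appl \<xi> (?x c)) * ?M c b)" for b
    using fun_cong[OF tensorial_expand[OF frame L br[OF f(4)] p], of b "?x b"]
    by (simp add: sum_fun_apply scaleR_fun_def br_coord sum_negf)
  have "trace (\<lambda>X. bracket A \<xi> (L X) - L (bracket A \<xi> X)) p =
      (\<Sum>b\<in>Basis. bracket A \<xi> (L (E b)) p (?x b) - L (bracket A \<xi> (E b)) p (?x b))"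
    unfolding trace_coordinates[OF frame L' p] by simp
  also have "\<dots> = (\<Sum>b\<in>Basis. \<xi> p (appl (L (E b)) (?x b)))
      - (\<Sum>b\<in>Basis. \<Sum>c\<in>Basis. ?M b c * E c p (appl \<xi> (?x b)))
      + (\<Sum>b\<in>Basis. \<Sum>c\<in>Basis. E b p (appl \<xi> (?x c)) * ?M c b)"
    unfolding L_br bracket_apply[OF xs] LE_apply[of _ "appl \<xi> (?x _)"]
    by (simp add: sum.distrib sum_subtractf)
  also have "(\<Sum>b\<in>Basis. \<Sum>c\<in>Basis. E b p (appl \<xi> (?x c)) * ?M c b) =
      (\<Sum>b\<in>Basis. \<Sum>c\<in>Basis. ?M b c * E c p (appl \<xi> (?x b)))"
    by (subst sum.swap) (simp add: mult.commute)
  finally show ?thesis unfolding lhs by (simp only: diff_add_cancel)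
qed

end

section \<open>Pseudo-Riemannian calculus\<close>

locale pseudo_riemannian = manifold A
  for A :: "('m::{t2_space,second_countable_topology}, 'e::euclidean_space) chart set" +
  fixes g :: "'m bilin" and nab :: "'m connection"
  assumes metric: "pseudo_metric A g" and levi_civita: "levi_civita A g nab"
begin

abbreviation "VF \<equiv> fields A"
abbreviation "C \<equiv> smooth_fun_on A UNIV"
abbreviation "G \<equiv> app2 g"
abbreviation "br \<equiv> bracket A"
abbreviation "R \<equiv> curvature A nab"

lemma C_simps [simp, intro]:
  "C (\<lambda>_. c)" "C 0" "C 1" "C (numeral n)"
  "C f \<Longrightarrow> C h \<Longrightarrow> C (f + h)" "C f \<Longrightarrow> C h \<Longrightarrow> C (f * h)"
  "C f \<Longrightarrow> C (- f)" "C f \<Longrightarrow> C h \<Longrightarrow> C (f - h)"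
proof -
  show const: "C (\<lambda>_. c)" for c by (simp add: smooth_fun_on_const)
  show "C 0" "C 1" "C (numeral n)"
    using const[of 0] const[of 1] const[of "numeral n"] by (simp_all add: zero_fun_def one_fun_def numeral_fun)
  show add: "C f \<Longrightarrow> C h \<Longrightarrow> C (f + h)" and mult: "C f \<Longrightarrow> C h \<Longrightarrow> C (f * h)" for f h
    by (simp_all add: smooth_fun_on_add smooth_fun_on_mult)
  show minus: "C (- f)" if "C f" for f
  proof -
    have "- f = (\<lambda>_. -1) * f" by (simp add: fun_eq_iff)
    then show ?thesis using mult[OF const that, of "-1"] by simp
  qed
  show "C f \<Longrightarrow> C h \<Longrightarrow> C (f - h)"
    using add[of f "- h"] minus[of h] by simp
qed

lemma C_appl [simp, intro]: "X \<in> VF \<Longrightarrow> C f \<Longrightarrow> C (appl X f)"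
  by (simp add: smooth_fun_on_appl)

lemma C_metric [simp, intro]: "X \<in> VF \<Longrightarrow> Y \<in> VF \<Longrightarrow> C (G X Y)"
  using metric unfolding pseudo_metric_def by blast

lemma connection: "affine_connection A nab" using levi_civita unfolding levi_civita_def by blast

lemma nab_VF [simp, intro]: "X \<in> VF \<Longrightarrow> Y \<in> VF \<Longrightarrow> nab X Y \<in> VF"
  using connection unfolding affine_connection_def by blast

lemma torsion_free: "X \<in> VF \<Longrightarrow> Y \<in> VF \<Longrightarrow> br X Y = nab X Y - nab Y X"
  using levi_civita unfolding levi_civita_def by simp

lemma br_VF [simp, intro]: "X \<in> VF \<Longrightarrow> Y \<in> VF \<Longrightarrow> br X Y \<in> VF"
  by (simp add: torsion_free)

lemma appl_metric:
  "X \<in> VF \<Longrightarrow> Y \<in> VF \<Longrightarrow> Z \<in> VF \<Longrightarrow> appl X (G Y Z) = G (nab X Y) Z + G Y (nab X Z)"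
  using levi_civita unfolding levi_civita_def by blast

lemma nab_add [simp]:
  "X \<in> VF \<Longrightarrow> Y \<in> VF \<Longrightarrow> Z \<in> VF \<Longrightarrow> nab (X + Y) Z = nab X Z + nab Y Z"
  "X \<in> VF \<Longrightarrow> Y \<in> VF \<Longrightarrow> Z \<in> VF \<Longrightarrow> nab X (Y + Z) = nab X Y + nab X Z"
  using connection unfolding affine_connection_def by blast+

lemma nab_fscale [simp]:
  "X \<in> VF \<Longrightarrow> Y \<in> VF \<Longrightarrow> C f \<Longrightarrow> nab (fscale f X) Y = fscale f (nab X Y)"
  "X \<in> VF \<Longrightarrow> Y \<in> VF \<Longrightarrow> C f \<Longrightarrow> nab X (fscale f Y) = fscale (appl X f) Y + fscale f (nab X Y)"
  using connection unfolding affine_connection_def by blast+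

lemma uminus_fscale: "- X = fscale (\<lambda>_. -1) X"
  by (simp add: fun_eq_iff fscale_def scaleR_fun_def)

lemma appl_const [simp]: "X \<in> VF \<Longrightarrow> appl X (\<lambda>_. c) = 0"
  "X \<in> VF \<Longrightarrow> appl X 0 = 0" "X \<in> VF \<Longrightarrow> appl X 1 = 0" "X \<in> VF \<Longrightarrow> appl X (numeral n) = 0"
  using tangent_const[OF field_tangent]
  by (simp_all add: appl_def fun_eq_iff zero_fun_def one_fun_def numeral_fun)

lemma nab_uminus [simp]:
  assumes "X \<in> VF" "Y \<in> VF"
  shows "nab (- X) Y = - nab X Y" "nab X (- Y) = - nab X Y"
  using nab_fscale[OF assms, of "\<lambda>_. -1"] assms by (simp_all add: uminus_fscale[symmetric] fscale_simps)

lemma nab_diff [simp]: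
  assumes "X \<in> VF" "Y \<in> VF" "Z \<in> VF"
  shows "nab (X - Y) Z = nab X Z - nab Y Z" "nab X (Y - Z) = nab X Y - nab X Z"
  using assms nab_add(1)[of X "- Y" Z] nab_add(2)[of X Y "- Z"] by simp_all

lemma appl_simps [simp]:
  assumes "X \<in> VF" "C f" "C h"
  shows "appl X (f + h) = appl X f + appl X h" "appl X (f - h) = appl X f - appl X h"
    "appl X (f * h) = f * appl X h + appl X f * h"
  using assms by (simp_all add: appl_def fun_eq_iff tangent_add[OF field_tangent]
      tangent_diff[OF field_tangent] tangent_mult[OF field_tangent] smooth_near_global)

lemma appl_uminus [simp]: "X \<in> VF \<Longrightarrow> C f \<Longrightarrow> appl X (- f) = - appl X f"
  using appl_simps(2)[of X 0 f] by simp

lemma appl_br: "X \<in> VF \<Longrightarrow> Y \<in> VF \<Longrightarrow> C f \<Longrightarrow> appl (br X Y) f = appl X (appl Y f) - appl Y (appl X f)"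
  by (simp add: fun_eq_iff bracket_apply[OF smooth_near_global] appl_def[of "br X Y"])
    (simp add: appl_def)

lemma metric_commute: "X \<in> VF \<Longrightarrow> Y \<in> VF \<Longrightarrow> G X Y = G Y X"
  using metric field_tangent[of X] field_tangent[of Y]
  by (simp add: pseudo_metric_def Let_def app2_def fun_eq_iff)

lemma metric_linear_right:
  assumes "X \<in> VF" "Y \<in> VF" "Z \<in> VF"
  shows "G X (Y + Z) = G X Y + G X Z" "G X (fscale f Y) = f * G X Y"
proof -
  have "lin_on (tangent_space A p) (g p (X p))" for p
    using metric field_tangent[OF assms(1)] by (simp add: pseudo_metric_def Let_def)
  then show "G X (Y + Z) = G X Y + G X Z" "G X (fscale f Y) = f * G X Y"
    using field_tangent assms by (auto simp: lin_on_def app2_def fun_eq_iff fscale_def)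
qed

lemma metric_uminus [simp]:
  assumes "X \<in> VF" "Y \<in> VF"
  shows "G X (- Y) = - G X Y" "G (- X) Y = - G X Y"
proof -
  have const: "(\<lambda>_. -1) * f = - f" for f :: "'m \<Rightarrow> real" by (simp add: fun_eq_iff)
  have minus: "G X (- Y) = - G X Y" if "X \<in> VF" "Y \<in> VF" for X Y
    unfolding uminus_fscale using metric_linear_right(2)[OF that that(2)] const by simp
  then show "G X (- Y) = - G X Y" using assms by blast
  show "G (- X) Y = - G X Y"
    using metric_commute[of "- X" Y] metric_commute[of X Y] minus[of Y X] assms by simp
qed

lemma metric_add [simp]:
  assumes "X \<in> VF" "Y \<in> VF" "Z \<in> VF"
  shows "G X (Y + Z) = G X Y + G X Z" "G (X + Y) Z = G X Z + G Y Z"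
    "G X (Y - Z) = G X Y - G X Z" "G (X - Y) Z = G X Z - G Y Z"
proof -
  have add: "G X (Y + Z) = G X Y + G X Z" if "X \<in> VF" "Y \<in> VF" "Z \<in> VF" for X Y Z
    using metric_linear_right[OF that] by auto
  have diff: "G X (Y - Z) = G X Y - G X Z" if "X \<in> VF" "Y \<in> VF" "Z \<in> VF" for X Y Z
    using add[of X Y "- Z"] metric_uminus[of X Z] that by simp
  show "G X (Y + Z) = G X Y + G X Z" "G X (Y - Z) = G X Y - G X Z"
    using add[OF assms] diff[OF assms] by auto
  show "G (X + Y) Z = G X Z + G Y Z" "G (X - Y) Z = G X Z - G Y Z"
    using metric_commute[of "X + Y" Z] metric_commute[of "X - Y" Z] metric_commute[of X Z]
      metric_commute[of Y Z] add[of Z X Y] diff[of Z X Y] assms by simp_all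
qed

lemma metric_fscale [simp]:
  assumes "X \<in> VF" "Y \<in> VF" "C f"
  shows "G X (fscale f Y) = f * G X Y" "G (fscale f X) Y = f * G X Y"
  using metric_linear_right(2)[of X Y Y f] metric_linear_right(2)[of Y X X f] assms
    metric_commute[of X Y] metric_commute[of "fscale f X" Y] by simp_all

lemma metric_zero [simp]: "X \<in> VF \<Longrightarrow> G X 0 = 0" "X \<in> VF \<Longrightarrow> G 0 X = 0"
  using metric_add(3)[of X X X] metric_add(4)[of X X X] by simp_all

lemma metric_nondegenerate:
  assumes "X \<in> VF" and "\<And>Z. Z \<in> VF \<Longrightarrow> G X Z p = 0"
  shows "X p = 0"
proof -
  have "g p (X p) w = 0" if "w \<in> tangent_space A p" for w
    using field_extension[OF that] assms(2) by (auto simp: app2_def)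
  then show ?thesis
    using metric field_tangent[OF assms(1), of p] by (simp add: pseudo_metric_def Let_def)
qed

text \<open>Identities between vector fields are proved by pairing both sides with a third field, which reduces
  them to the commutative ring of functions.\<close>

lemma field_eqI:
  assumes "X \<in> VF" "Y \<in> VF" and "\<And>Z. Z \<in> VF \<Longrightarrow> G X Z = G Y Z"
  shows "X = Y"
proof
  fix p
  have "(X - Y) p = 0"
    by (rule metric_nondegenerate[of "X - Y"]) (use assms in auto)
  then show "X p = Y p" by simp
qed

subsection \<open>Symmetries of the curvature\<close>

lemma curvature_VF [simp, intro]: "X \<in> VF \<Longrightarrow> Y \<in> VF \<Longrightarrow> Z \<in> VF \<Longrightarrow> R X Y Z \<in> VF"
  unfolding curvature_def by simp

lemma br_skew: "X \<in> VF \<Longrightarrow> Y \<in> VF \<Longrightarrow> br Y X = - br X Y"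
  by (simp add: torsion_free)

lemma curvature_skew: "X \<in> VF \<Longrightarrow> Y \<in> VF \<Longrightarrow> Z \<in> VF \<Longrightarrow> R Y X Z = - R X Y Z"
  by (simp add: curvature_def br_skew[of X Y])

lemma curvature_add [simp]:
  "X \<in> VF \<Longrightarrow> X' \<in> VF \<Longrightarrow> Y \<in> VF \<Longrightarrow> Z \<in> VF \<Longrightarrow> R (X + X') Y Z = R X Y Z + R X' Y Z"
  by (simp add: curvature_def torsion_free algebra_simps)

lemma curvature_fscale [simp]:
  "X \<in> VF \<Longrightarrow> Y \<in> VF \<Longrightarrow> Z \<in> VF \<Longrightarrow> C f \<Longrightarrow> R (fscale f X) Y Z = fscale f (R X Y Z)"
  by (simp add: curvature_def torsion_free fscale_simps algebra_simps)

lemma tensorial_curvature: "Y \<in> VF \<Longrightarrow> Z \<in> VF \<Longrightarrow> tensorial (\<lambda>X. R X Y Z)"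
  by (simp add: tensorial_def)

lemma Ric_eq_trace: "Ric A nab Y Z = trace (\<lambda>X. R X Y Z)"
  by (simp add: Ric_def trace_def)

text \<open>The commutator relation for derivations, applied to the function \<open>g(Z, W)\<close>.\<close>

lemma curvature_metric_skew:
  assumes "X \<in> VF" "Y \<in> VF" "Z \<in> VF" "W \<in> VF"
  shows "G (R X Y Z) W = - G (R X Y W) Z"
proof -
  have "appl X (appl Y (G Z W)) - appl Y (appl X (G Z W)) - appl (br X Y) (G Z W) = 0"
    using assms by (simp add: appl_br)
  moreover have "appl X (appl Y (G Z W)) - appl Y (appl X (G Z W)) - appl (br X Y) (G Z W) =
      G (R X Y Z) W + G Z (R X Y W)"
    using assms by (simp add: appl_metric curvature_def algebra_simps)
  ultimately show ?thesis
    using assms metric_commute[of Z "R X Y W"] by (simp add: eq_neg_iff_add_eq_0)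
qed

text \<open>For a torsion-free connection the cyclic sum collapses to the Jacobi identity.\<close>

lemma curvature_bianchi:
  assumes "X \<in> VF" "Y \<in> VF" "Z \<in> VF"
  shows "R X Y Z + R Y Z X + R Z X Y = 0"
proof -
  have j: "br X (br Y Z) = br (br X Y) Z + br Y (br X Z)" by (rule bracket_jacobi) (use assms in auto)
  have "R X Y Z + R Y Z X + R Z X Y = br X (br Y Z) + br Y (br Z X) + br Z (br X Y)"
    using assms by (simp add: curvature_def torsion_free algebra_simps)
  also have "\<dots> = 0"
    unfolding j br_skew[OF assms(1,3)]
    using assms br_skew[of "br X Y" Z] by (simp add: torsion_free[of Y])
  finally show ?thesis .
qed

text \<open>The octahedron argument: add the Bianchi identities for four cyclic shifts of the arguments.\<close>

lemma curvature_pair_symmetry: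
  assumes V: "X \<in> VF" "Y \<in> VF" "Z \<in> VF" "W \<in> VF"
  shows "G (R X Y Z) W = G (R Z W X) Y"
proof
  fix p
  let ?r = "\<lambda>X Y Z W. G (R X Y Z) W p"
  have s1: "?r Y X Z W = - ?r X Y Z W" if "X \<in> VF" "Y \<in> VF" "Z \<in> VF" "W \<in> VF" for X Y Z W
    using that by (simp add: curvature_skew[of X Y])
  have s2: "?r X Y W Z = - ?r X Y Z W" if "X \<in> VF" "Y \<in> VF" "Z \<in> VF" "W \<in> VF" for X Y Z W
    using curvature_metric_skew[OF that(1,2,4,3)] by simp
  have b: "?r X Y Z W + ?r Y Z X W + ?r Z X Y W = 0"
    if "X \<in> VF" "Y \<in> VF" "Z \<in> VF" "W \<in> VF" for X Y Z W
  proof -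
    have "G (R X Y Z + R Y Z X + R Z X Y) W p = 0"
      using curvature_bianchi[OF that(1-3)] that by simp
    then show ?thesis using that by simp
  qed
  show "?r X Y Z W = ?r Z W X Y"
    using b[OF V(1,2,3,4)] b[OF V(2,3,4,1)] b[OF V(3,4,1,2)] b[OF V(4,1,2,3)]
      s2[OF V(1,2,3,4)] s2[OF V(3,4,1,2)] s1[OF V(1,2,3,4)] s1[OF V(3,4,1,2)]
      s1[OF V(2,3,4,1)] s2[OF V(2,3,4,1)] s1[OF V(4,1,2,3)] s2[OF V(4,1,2,3)]
      s1[OF V(3,1,2,4)] s2[OF V(3,1,2,4)] s1[OF V(2,4,3,1)] s2[OF V(2,4,3,1)]
      s1[OF V(2,3,1,4)] s2[OF V(2,3,1,4)] s1[OF V(4,2,3,1)] s2[OF V(4,2,3,1)]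
      s1[OF V(4,1,3,2)] s2[OF V(4,1,3,2)] s1[OF V(1,3,4,2)] s2[OF V(1,3,4,2)] s1[OF V(1,3,2,4)] s2[OF V(1,3,2,4)]
      s1[OF V(4,2,1,3)] s2[OF V(4,2,1,3)] s1[OF V(3,1,4,2)]  s2[OF V(3,1,4,2)]
    by (smt (verit))
qed

end

section \<open>Kenmotsu pseudo-metric manifolds\<close>

text \<open>Vector fields are functions, so they also carry a pointwise product, which the simplifier uses
  to collect equal summands; these rules turn such products into scalar multiples.\<close>

lemma numeral_times_field [simp]:
  fixes X :: "'m field"
  shows "numeral n * X = fscale (numeral n) X" "X * numeral n = fscale (numeral n) X"
  by (simp_all add: fun_eq_iff fscale_def scaleR_fun_def)

context manifold
begin

lemma common_kernel_vector:
  assumes "DIM('e) > 3" and "lin_on (tangent_space A p) \<alpha>" "lin_on (tangent_space A p) \<beta>"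
    "lin_on (tangent_space A p) (\<gamma> :: 'm tangent \<Rightarrow> real)"
  shows "\<exists>v\<in>tangent_space A p. v \<noteq> 0 \<and> \<alpha> v = (0::real) \<and> \<beta> v = (0::real) \<and> \<gamma> v = 0"
proof -
  obtain U x where c: "(U, x) \<in> A" "p \<in> U" using chart_exists by blast
  let ?l = "coord_vector A (U, x) p"
  have T: "?l u \<in> tangent_space A p" for u using tangent_space_chart[OF c] by simp
  have l: "?l (u + v) = ?l u + ?l v" "?l (r *\<^sub>R u) = r *\<^sub>R ?l u" for u v r
    using linear_coord_vector[OF c] by (auto dest: linear_add linear_cmul)
  let ?h = "\<lambda>u. (\<alpha> (?l u), \<beta> (?l u), \<gamma> (?l u))"
  have lin: "linear ?h"
    using assms(2-4) T unfolding lin_on_def by (intro linearI) (simp_all add: l)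
  have "\<not> inj ?h"
  proof
    assume "inj ?h"
    then have "dim (range ?h) = dim (UNIV :: 'e set)"
      by (intro dim_image_eq[OF lin]) simp
    also have "\<dots> > 3" using assms(1) by simp
    finally show False using dim_subset_UNIV[of "range ?h"] by simp
  qed
  then obtain u where u: "u \<noteq> 0" "?h u = 0" using linear_injective_0[OF lin] by blast
  obtain b where "b \<in> Basis" "u \<bullet> b \<noteq> 0" using u(1) euclidean_eq_iff[of u 0] by auto
  then have "?l u \<noteq> 0" using coord_vector_coordinate[OF c, of u b] by auto
  then show ?thesis using T[of u] u(2) by (intro bexI[of _ "?l u"]) (simp_all add: zero_prod_def)
qed

lemma trace_cong:
  assumes "tensorial L" "\<And>X. X \<in> fields A \<Longrightarrow> L X = L' X"
  shows "tensorial L'" "trace L' p = trace L p"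
proof -
  show t: "tensorial L'"
    using assms(1) unfolding tensorial_def by (simp add: assms(2)[symmetric])
  obtain U x N E where p: "p \<in> N" and frame: "coordinate_frame U x N E"
    using coordinate_frame_exists by blast
  note tr = trace_coordinates[OF frame _ p]
  show "trace L' p = trace L p"
    unfolding tr[OF t] tr[OF assms(1)] using assms(2) coordinate_frameD(4)[OF frame] by simp
qed

lemma tensorial_add: "tensorial L \<Longrightarrow> tensorial L' \<Longrightarrow> tensorial (\<lambda>X. L X + L' X)"
  unfolding tensorial_def by (simp add: fscale_simps)

lemma tensorial_scalar: "smooth_fun_on A UNIV h \<Longrightarrow> tensorial (\<lambda>X. fscale h X)"
  unfolding tensorial_def by (simp add: fscale_simps mult.commute)

lemma trace_scalar:
  assumes "smooth_fun_on A UNIV h"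
  shows "trace (\<lambda>X. fscale h X) p = h p * DIM('e)"
  using trace_fscale[of "\<lambda>X. X" h p] assms by (simp add: tensorial_def trace_id)

end

locale kenmotsu = pseudo_riemannian A g nab
  for A :: "('m::{t2_space,second_countable_topology}, 'e::euclidean_space) chart set"
    and g :: "'m bilin" and nab :: "'m connection" +
  fixes \<epsilon> :: real and \<phi> :: "'m endo" and \<xi> :: "'m field" and \<eta> :: "'m form"
  assumes kenmotsu: "kenmotsu_pseudo_metric A \<epsilon> \<phi> \<xi> \<eta> g nab"
begin

abbreviation "P \<equiv> appE \<phi>"
abbreviation "e \<equiv> app1 \<eta>"
abbreviation E :: "'m \<Rightarrow> real" where "E \<equiv> \<lambda>_. \<epsilon>"

lemma contact: "almost_contact_pseudo_metric A \<epsilon> \<phi> \<xi> \<eta> g"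
  using kenmotsu unfolding kenmotsu_pseudo_metric_def by blast

lemma epsilon: "\<epsilon> * \<epsilon> = 1" "\<epsilon> \<noteq> 0"
  using contact by (auto simp: almost_contact_pseudo_metric_def)

lemma E_square [simp]: "E * E = 1" "E * (E * f) = f"
  using epsilon(1) by (simp_all add: fun_eq_iff flip: mult.assoc)

lemma contact_VF [simp, intro]: "\<xi> \<in> VF" "X \<in> VF \<Longrightarrow> P X \<in> VF" "X \<in> VF \<Longrightarrow> C (e X)"
  using contact by (simp_all add: almost_contact_pseudo_metric_def endo_field_def one_form_def)

lemma eta_linear [simp]:
  assumes "X \<in> VF"
  shows "Y \<in> VF \<Longrightarrow> e (X + Y) = e X + e Y" "Y \<in> VF \<Longrightarrow> e (X - Y) = e X - e Y"
    "e (- X) = - e X" "e (fscale f X) = f * e X"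
proof -
  have lin: "lin_on (tangent_space A p) (\<eta> p)" for p
    using contact by (simp add: almost_contact_pseudo_metric_def one_form_def)
  have add: "e (X + Y) = e X + e Y" if "X \<in> VF" "Y \<in> VF" for X Y
    using lin that field_tangent by (auto simp: lin_on_def app1_def fun_eq_iff)
  have scale: "e (fscale f X) = f * e X" if "X \<in> VF" for f X
    using lin that field_tangent by (auto simp: lin_on_def app1_def fun_eq_iff fscale_def)
  have minus: "e (- X) = - e X" if "X \<in> VF" for X
    unfolding uminus_fscale scale[OF that] by (simp add: fun_eq_iff)
  show "e (fscale f X) = f * e X" "e (- X) = - e X" using scale minus assms by auto
  show "e (X + Y) = e X + e Y" if "Y \<in> VF" using add assms that by blast
  show "e (X - Y) = e X - e Y" if "Y \<in> VF"
    using add[of X "- Y"] minus[of Y] assms that by simp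
qed

lemma phi_linear [simp]:
  assumes "X \<in> VF"
  shows "Y \<in> VF \<Longrightarrow> P (X + Y) = P X + P Y" "Y \<in> VF \<Longrightarrow> P (X - Y) = P X - P Y"
    "P (- X) = - P X" "P (fscale f X) = fscale f (P X)"
proof -
  have lin: "lin_on (tangent_space A p) (\<phi> p)" for p
    using contact by (simp add: almost_contact_pseudo_metric_def endo_field_def)
  have add: "P (X + Y) = P X + P Y" if "X \<in> VF" "Y \<in> VF" for X Y
    by (rule ext) (use lin that field_tangent in \<open>auto simp: lin_on_def appE_def\<close>)
  have scale: "P (fscale f X) = fscale f (P X)" if "X \<in> VF" for f X
    by (rule ext) (use lin that field_tangent in \<open>auto simp: lin_on_def appE_def fscale_def\<close>)
  have minus: "P (- X) = - P X" if "X \<in> VF" for X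
    unfolding uminus_fscale by (rule scale[OF that])
  show "P (fscale f X) = fscale f (P X)" "P (- X) = - P X" using scale minus assms by auto
  show "P (X + Y) = P X + P Y" if "Y \<in> VF" using add assms that by blast
  show "P (X - Y) = P X - P Y" if "Y \<in> VF"
    using add[of X "- Y"] minus[of Y] assms that by simp
qed

lemma contact_simps [simp]:
  "e \<xi> = 1" "P \<xi> = 0" "X \<in> VF \<Longrightarrow> e (P X) = 0" "X \<in> VF \<Longrightarrow> P (P X) = - X + fscale (e X) \<xi>"
  using contact by (simp_all add: almost_contact_pseudo_metric_def fun_eq_iff[of _ 0] fun_eq_iff[of _ 1])

lemma metric_phi_phi: "X \<in> VF \<Longrightarrow> Y \<in> VF \<Longrightarrow> G (P X) (P Y) = G X Y - E * e X * e Y"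
  using contact by (simp add: almost_contact_pseudo_metric_def fun_eq_iff)

lemma metric_xi [simp]:
  assumes "X \<in> VF" shows "G X \<xi> = E * e X" "G \<xi> X = E * e X"
  using metric_phi_phi[OF assms, of \<xi>] assms metric_commute[of \<xi> X] by simp_all

lemma metric_phi_skew:
  assumes "X \<in> VF" "Y \<in> VF" shows "G (P X) Y = - G X (P Y)"
proof -
  have "- G (P X) Y = G X (P Y)" using metric_phi_phi[of X "P Y"] assms by simp
  then show ?thesis by (metis minus_minus)
qed

lemma nab_phi:
  assumes "X \<in> VF" "Y \<in> VF"
  shows "nab X (P Y) = P (nab X Y) - fscale (e Y) (P X) - fscale (E * G X (P Y)) \<xi>"
proof -
  have "nab X (P Y) - P (nab X Y) =
      - fscale (e Y) (P X) - fscale (\<lambda>p. \<epsilon> * G X (P Y) p) \<xi>"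
    using kenmotsu assms by (simp add: kenmotsu_pseudo_metric_def)
  moreover have "(\<lambda>p. \<epsilon> * G X (P Y) p) = E * G X (P Y)" by (simp add: fun_eq_iff)
  ultimately show ?thesis by (simp add: algebra_simps)
qed

text \<open>Applying the structure equation to \<open>\<phi> \<xi> = 0\<close> determines the covariant derivative of \<open>\<xi>\<close> up to a multiple
  of \<open>\<xi>\<close>, which vanishes because \<open>\<xi>\<close> has constant length.\<close>

lemma nab_xi [simp]:
  assumes X: "X \<in> VF"
  shows "nab X \<xi> = X - fscale (e X) \<xi>"
proof -
  have "2 * (E * e (nab X \<xi>)) = 0"
    using appl_metric[of X \<xi> \<xi>] X by simp
  then have e0: "e (nab X \<xi>) = 0" by (simp add: fun_eq_iff epsilon)
  have "nab X 0 = 0" using nab_diff(2)[of X X X] X by simp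
  then have "P (nab X \<xi>) = P X" using nab_phi[of X \<xi>] X by (simp add: fscale_simps)
  then have "P (P (nab X \<xi>)) = P (P X)" by simp
  then have "- nab X \<xi> = - X + fscale (e X) \<xi>" using X e0 by (simp add: fscale_simps)
  from arg_cong[OF this, of uminus] show ?thesis by simp
qed

lemma appl_eta:
  assumes "X \<in> VF" "Y \<in> VF"
  shows "appl X (e Y) = e (nab X Y) + E * G X Y - e X * e Y"
proof -
  have "e Y = E * G Y \<xi>" using assms by simp
  then have "appl X (e Y) = appl X (E * G Y \<xi>)" by simp
  also have "\<dots> = E * (G (nab X Y) \<xi> + G Y (nab X \<xi>))"
    using assms by (simp only: appl_simps appl_metric contact_VF C_simps C_metric appl_const) simp
  also have "\<dots> = e (nab X Y) + E * G X Y - e X * e Y"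
    using assms by (simp add: algebra_simps metric_commute)
  finally show ?thesis .
qed

lemma curvature_xi:
  assumes "X \<in> VF" "Y \<in> VF"
  shows "R X Y \<xi> = fscale (e X) Y - fscale (e Y) X"
  using assms
  by (simp add: curvature_def torsion_free appl_eta fscale_simps metric_commute algebra_simps)

text \<open>Pair symmetry transports the knowledge of \<open>R(Y, W) \<xi>\<close>.\<close>

lemma curvature_of_xi:
  assumes "X \<in> VF" "Y \<in> VF"
  shows "R \<xi> X Y = fscale (e Y) X - fscale (E * G X Y) \<xi>"
proof (rule field_eqI)
  fix W assume W: "W \<in> VF"
  have "G (R \<xi> X Y) W = G (R Y W \<xi>) X" by (rule curvature_pair_symmetry) (use assms W in auto)
  also have "\<dots> = G (fscale (e Y) X - fscale (E * G X Y) \<xi>) W"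
    using assms W by (simp add: curvature_xi metric_commute algebra_simps)
  finally show "G (R \<xi> X Y) W = G (fscale (e Y) X - fscale (E * G X Y) \<xi>) W" .
qed (use assms in auto)

text \<open>The curvature corrected by the one of constant curvature \<open>-\<epsilon>\<close>. It has the
  symmetries of the curvature of a Kaehler manifold; indeed, in a local description of the manifold as
  a warped product of a line with a Kaehler manifold, it is the curvature of the latter.\<close>

definition K :: "'m field \<Rightarrow> 'm field \<Rightarrow> 'm field \<Rightarrow> 'm field" where
  "K X Y U = R X Y U + fscale (E * G Y U) X - fscale (E * G X U) Y"

lemma K_VF [simp, intro]: "X \<in> VF \<Longrightarrow> Y \<in> VF \<Longrightarrow> U \<in> VF \<Longrightarrow> K X Y U \<in> VF"
  unfolding K_def by simp

text \<open>Commuting two covariant derivatives in the structure equation for \<open>\<phi>\<close> yields the commutator of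
  \<open>R(X, Y)\<close> and \<open>\<phi>\<close>; the correction term in \<open>K\<close> absorbs it.\<close>

lemma K_phi:
  assumes "X \<in> VF" "Y \<in> VF" "U \<in> VF"
  shows "K X Y (P U) = P (K X Y U)"
proof (rule field_eqI)
  fix W assume W: "W \<in> VF"
  note comm = metric_commute
  show "G (K X Y (P U)) W = G (P (K X Y U)) W"
    using assms W
    by (simp add: K_def curvature_def torsion_free nab_phi appl_eta appl_metric
        metric_phi_skew[of X] metric_phi_skew[of Y] metric_commute) (simp add: algebra_simps)
qed (use assms in auto)

lemma K_pair_symmetry:
  assumes "X \<in> VF" "Y \<in> VF" "U \<in> VF" "W \<in> VF"
  shows "G (K X Y U) W = G (K U W X) Y"
  using assms curvature_pair_symmetry[OF assms]
  by (simp add: K_def metric_commute algebra_simps)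

subsection \<open>The Lie derivative along the Reeb field\<close>

lemma br_xi: "X \<in> VF \<Longrightarrow> br \<xi> X = nab \<xi> X - X + fscale (e X) \<xi>"
  by (simp add: torsion_free algebra_simps)

lemma appl_xi_eta: "X \<in> VF \<Longrightarrow> appl \<xi> (e X) = e (br \<xi> X)"
  by (simp add: appl_eta br_xi)

lemma appl_xi_metric:
  assumes "X \<in> VF" "Y \<in> VF"
  shows "appl \<xi> (G X Y) = G (br \<xi> X) Y + G X (br \<xi> Y) + 2 * (G X Y - E * e X * e Y)"
  using assms by (simp add: appl_metric br_xi algebra_simps)

text \<open>The Lie derivative of the connection along \<open>\<xi>\<close> is \<open>\<nabla>\<^sup>2\<xi> + R(\<xi>, X) Y\<close>, and both terms are known.\<close>

lemma lie_connection:
  assumes "X \<in> VF" "Y \<in> VF"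
  shows "br \<xi> (nab X Y) = nab (br \<xi> X) Y + nab X (br \<xi> Y)
    + fscale (- (2 * E * (G X Y - E * e X * e Y))) \<xi>"
proof -
  have eq: "nab \<xi> (nab X Y) = nab X (nab \<xi> Y) + nab (br \<xi> X) Y + (fscale (e Y) X - fscale (E * G X Y) \<xi>)"
    using curvature_of_xi[OF assms] by (simp add: curvature_def algebra_simps)
  show ?thesis
  proof (rule field_eqI)
    fix W assume W: "W \<in> VF"
    show "G (br \<xi> (nab X Y)) W = G (nab (br \<xi> X) Y + nab X (br \<xi> Y)
      + fscale (- (2 * E * (G X Y - E * e X * e Y))) \<xi>) W"
      unfolding br_xi[OF nab_VF[OF assms]] eq
      using assms W by (simp add: br_xi appl_eta) (simp add: algebra_simps)
  qed (use assms in auto)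
qed

text \<open>The Lie derivative of the curvature is the antisymmetrised covariant derivative of that of the
  connection. The result says that the Lie derivative of \<open>K\<close> along \<open>\<xi>\<close> vanishes.\<close>

lemma lie_curvature:
  assumes "X \<in> VF" "Y \<in> VF" "U \<in> VF"
  shows "br \<xi> (R X Y U) = R (br \<xi> X) Y U + R X (br \<xi> Y) U + R X Y (br \<xi> U)
    + fscale (2 * E * (G X U - E * e X * e U)) Y - fscale (2 * E * (G Y U - E * e Y * e U)) X"
proof -
  have br_add: "br \<xi> (X - Y) = br \<xi> X - br \<xi> Y" if "X \<in> VF" "Y \<in> VF" for X Y
    using that by (simp add: torsion_free fscale_simps algebra_simps)
  have jac: "br \<xi> (br X Y) = br (br \<xi> X) Y + br X (br \<xi> Y)"
    using assms by (intro bracket_jacobi) auto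
  define h where "h X Y = - (2 * E * (G X Y - E * e X * e Y))" for X Y
  have lie: "br \<xi> (nab X Y) = nab (br \<xi> X) Y + nab X (br \<xi> Y) + fscale (h X Y) \<xi>"
    if "X \<in> VF" "Y \<in> VF" for X Y
    using lie_connection[OF that] unfolding h_def .
  have hC: "C (h X Y)" if "X \<in> VF" "Y \<in> VF" for X Y
    unfolding h_def using that by simp
  have second: "br \<xi> (nab X (nab Y U)) = nab (br \<xi> X) (nab Y U) + nab X (nab (br \<xi> Y) U)
      + nab X (nab Y (br \<xi> U)) + nab X (fscale (h Y U) \<xi>) + fscale (h X (nab Y U)) \<xi>"
    if "X \<in> VF" "Y \<in> VF" "U \<in> VF" for X Y U
    using that by (simp add: lie hC del: nab_fscale nab_xi)
  have "br \<xi> (R X Y U) = br \<xi> (nab X (nab Y U)) - br \<xi> (nab Y (nab X U)) - br \<xi> (nab (br X Y) U)"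
    using assms by (simp add: curvature_def br_add)
  also have "\<dots> = R (br \<xi> X) Y U + R X (br \<xi> Y) U + R X Y (br \<xi> U)
     + (nab X (fscale (h Y U) \<xi>) + fscale (h X (nab Y U)) \<xi>
      - nab Y (fscale (h X U) \<xi>) - fscale (h Y (nab X U)) \<xi> - fscale (h (br X Y) U) \<xi>)"
    using assms by (simp add: second lie hC jac curvature_def del: nab_fscale nab_xi)
  also have "nab X (fscale (h Y U) \<xi>) + fscale (h X (nab Y U)) \<xi>
      - nab Y (fscale (h X U) \<xi>) - fscale (h Y (nab X U)) \<xi> - fscale (h (br X Y) U) \<xi>
      = fscale (2 * E * (G X U - E * e X * e U)) Y - fscale (2 * E * (G Y U - E * e Y * e U)) X"
    (is "?lhs = ?rhs")
  proof (rule field_eqI)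
    fix W assume "W \<in> VF"
    then show "G ?lhs W = G ?rhs W"
      using assms
      by (simp add: h_def torsion_free appl_eta appl_metric metric_commute) (simp add: algebra_simps)
  qed (use assms hC in auto)
  finally show ?thesis by (simp only: add_diff_eq)
qed

end

section \<open>Eta-Einstein Kenmotsu manifolds\<close>

locale eta_einstein_kenmotsu = kenmotsu A g nab \<epsilon> \<phi> \<xi> \<eta>
  for A :: "('m::{t2_space,second_countable_topology}, 'e::euclidean_space) chart set"
    and g :: "'m bilin" and nab :: "'m connection"
    and \<epsilon> :: real and \<phi> :: "'m endo" and \<xi> :: "'m field" and \<eta> :: "'m form" +
  fixes a b :: "'m \<Rightarrow> real" and n :: nat
  assumes dimension: "DIM('e) = 2 * n + 1" "n \<ge> 2"
    and eta_einstein: "eta_einstein_with A \<eta> g nab a b"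
begin

abbreviation N :: "'m \<Rightarrow> real" where "N \<equiv> \<lambda>_. 2 * real n"

lemma dim: "DIM('e) > 3" "real DIM('e) = 2 * real n + 1"
  using dimension by simp_all

lemma C_ab [simp, intro]: "C a" "C b"
  using eta_einstein by (simp_all add: eta_einstein_with_def)

lemma Ric_ab:
  assumes "X \<in> VF" "Y \<in> VF"
  shows "Ric A nab X Y = a * G X Y + b * e X * e Y"
  using eta_einstein assms by (simp add: eta_einstein_with_def fun_eq_iff)

lemma eta_rank_one:
  assumes "Y \<in> VF"
  shows "trace (\<lambda>X. fscale (e X) Y) p = e Y p" "tensorial (\<lambda>X. fscale (e X) Y)"
  by (rule trace_rank_one[where \<alpha> = e]; use assms in simp)+

lemma metric_rank_one:
  assumes "Y \<in> VF" "Z \<in> VF" "C h"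
  shows "trace (\<lambda>X. fscale (h * G X Z) Y) p = (h * G Y Z) p" "tensorial (\<lambda>X. fscale (h * G X Z) Y)"
  by (rule trace_rank_one[where \<alpha> = "\<lambda>X. h * G X Z"]; use assms in \<open>simp add: algebra_simps\<close>)+

text \<open>Compare the two expressions for \<open>Ric(\<xi>, \<xi>)\<close>: the trace of \<open>R(X, \<xi>) \<xi> = \<eta>(X) \<xi> - X\<close> is \<open>- 2 n\<close>.\<close>

lemma a_eq: "a = - (E * (N + b))"
proof
  fix p
  have R: "R X \<xi> \<xi> = fscale (e X) \<xi> + fscale (\<lambda>_. -1) X" if "X \<in> VF" for X
    using that by (simp add: curvature_xi fscale_simps uminus_fscale[of X])
  have "Ric A nab \<xi> \<xi> p = trace (\<lambda>X. fscale (e X) \<xi> + fscale (\<lambda>_. -1) X) p"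
    unfolding Ric_eq_trace
    by (rule trace_cong(2)[symmetric, OF tensorial_curvature]) (simp_all add: R)
  also have "\<dots> = e \<xi> p - DIM('e)"
    by (simp add: trace_add[OF eta_rank_one(2) tensorial_scalar] eta_rank_one(1) trace_scalar)
  finally have "a p * \<epsilon> + b p = - (2 * real n)"
    by (simp add: Ric_ab dim)
  moreover have "\<epsilon> * \<epsilon> = 1" by (rule epsilon(1))
  ultimately show "a p = (- (E * (N + b))) p" by simp algebra
qed

lemma horizontal_field:
  obtains Y where "Y \<in> VF" "Y p \<noteq> 0" "e Y p = 0"
proof -
  have lin: "lin_on (tangent_space A p) (\<eta> p)"
    using contact by (simp add: almost_contact_pseudo_metric_def one_form_def)
  obtain v where "v \<in> tangent_space A p" "v \<noteq> 0" "\<eta> p v = 0"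
    using common_kernel_vector[OF dim(1) lin lin lin] by blast
  then show ?thesis using field_extension[of v p] that by (auto simp: app1_def)
qed

lemma horizontal_pair:
  obtains Y W where "Y \<in> VF" "W \<in> VF" "e Y p = 0" "G Y W p \<noteq> 0"
proof -
  obtain Y where Y: "Y \<in> VF" "Y p \<noteq> 0" "e Y p = 0" by (rule horizontal_field)
  then obtain W where "W \<in> VF" "G Y W p \<noteq> 0" using metric_nondegenerate[OF Y(1)] by blast
  then show ?thesis using that Y by blast
qed

text \<open>The trace over \<open>X\<close> of the formula for the Lie derivative of \<open>R(X, Y) U\<close>.\<close>

lemma lie_Ric:
  assumes "Y \<in> VF" "U \<in> VF"
  shows "appl \<xi> (Ric A nab Y U) = Ric A nab (br \<xi> Y) U + Ric A nab Y (br \<xi> U)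
    - 2 * E * N * (G Y U - E * e Y * e U)"
proof
  fix p
  let ?h = "- (2 * E * (G Y U - E * e Y * e U))" and ?k = "- (2 * e U)"
  let ?L1 = "\<lambda>X. R X (br \<xi> Y) U" and ?L2 = "\<lambda>X. R X Y (br \<xi> U)" and ?L3 = "\<lambda>X. fscale ?h X"
    and ?L4 = "\<lambda>X. fscale (2 * E * G X U) Y" and ?L5 = "\<lambda>X. fscale ?k (fscale (e X) Y)"
  let ?L = "\<lambda>X. ?L1 X + (?L2 X + (?L3 X + (?L4 X + ?L5 X)))"
  have lie: "br \<xi> (R X Y U) - R (br \<xi> X) Y U = ?L X" if "X \<in> VF" for X
  proof (rule field_eqI)
    fix W assume "W \<in> VF"
    then show "G (br \<xi> (R X Y U) - R (br \<xi> X) Y U) W = G (?L X) W"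
      using that assms by (simp add: lie_curvature) (simp add: algebra_simps)
  qed (use that assms in auto)
  have t1: "tensorial ?L1" and t2: "tensorial ?L2" using assms by (simp_all add: tensorial_curvature)
  have t3: "tensorial ?L3" by (rule tensorial_scalar) (use assms in simp)
  have t4: "tensorial ?L4" and tr4: "trace ?L4 p = (2 * E * G Y U) p"
    using metric_rank_one[of Y U "2 * E"] assms by simp_all
  have t5: "tensorial ?L5"
    using eta_rank_one(2)[OF assms(1)] assms by (simp add: tensorial_def fscale_simps algebra_simps)
  have tr5: "trace ?L5 p = ?k p * e Y p"
    using trace_fscale[OF eta_rank_one(2)[OF assms(1)], of ?k p] eta_rank_one(1)[OF assms(1)] assms by simp
  have t: "tensorial ?L" by (intro tensorial_add t1 t2 t3 t4 t5)
  have tL: "tensorial (\<lambda>X. br \<xi> (R X Y U) - R (br \<xi> X) Y U)"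
    by (rule trace_cong(1)[OF t]) (simp add: lie)
  have "appl \<xi> (Ric A nab Y U) p = trace (\<lambda>X. br \<xi> (R X Y U) - R (br \<xi> X) Y U) p"
    unfolding Ric_eq_trace by (rule appl_trace[OF _ _ tensorial_curvature tL]) (use assms in auto)
  also have "\<dots> = trace ?L p"
    by (rule trace_cong(2)[OF t]) (simp add: lie)
  also have "\<dots> = trace ?L1 p + trace ?L2 p + trace ?L3 p + trace ?L4 p + trace ?L5 p"
    by (simp only: trace_add[OF t1 tensorial_add[OF t2 tensorial_add[OF t3 tensorial_add[OF t4 t5]]]]
        trace_add[OF t2 tensorial_add[OF t3 tensorial_add[OF t4 t5]]]
        trace_add[OF t3 tensorial_add[OF t4 t5]] trace_add[OF t4 t5] add.assoc)
  finally have sum: "appl \<xi> (Ric A nab Y U) p =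
      trace ?L1 p + trace ?L2 p + trace ?L3 p + trace ?L4 p + trace ?L5 p" .
  have tr3: "trace ?L3 p = ?h p * DIM('e)"
    by (rule trace_scalar) (use assms in simp)
  have eq: "appl \<xi> (Ric A nab Y U) p = Ric A nab (br \<xi> Y) U p + Ric A nab Y (br \<xi> U) p
      + ?h p * DIM('e) + (2 * E * G Y U) p + ?k p * e Y p"
    using sum unfolding tr3 tr4 tr5 Ric_eq_trace .
  have "\<epsilon> * \<epsilon> = 1" by (rule epsilon(1))
  then show "appl \<xi> (Ric A nab Y U) p = (Ric A nab (br \<xi> Y) U + Ric A nab Y (br \<xi> U)
    - 2 * E * N * (G Y U - E * e Y * e U)) p"
    unfolding eq dim(2) by simp algebra
qed

text \<open>Inserting the \<open>\<eta>\<close>-Einstein form of \<open>Ric\<close> into \<open>lie_Ric\<close> leaves \<open>(\<xi> b + 2 b) g(\<phi> Y, \<phi> W) = 0\<close>.\<close>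

lemma appl_xi_b: "appl \<xi> b = - (2 * b)"
proof
  fix p
  obtain Y W where YW: "Y \<in> VF" "W \<in> VF" "e Y p = 0" "G Y W p \<noteq> 0" by (rule horizontal_pair)
  have "appl \<xi> (Ric A nab Y W) p = (Ric A nab (br \<xi> Y) W + Ric A nab Y (br \<xi> W)
    - 2 * E * N * (G Y W - E * e Y * e W)) p"
    using lie_Ric[OF YW(1,2)] by simp
  moreover have "appl \<xi> (e Y) p = e (br \<xi> Y) p" using appl_xi_eta YW by simp
  ultimately have "- (\<epsilon> * (appl \<xi> b p * G Y W p)) = \<epsilon> * (b p * (2 * G Y W p))"
    using YW
    by (simp add: Ric_ab a_eq appl_xi_metric appl_xi_eta) (simp add: algebra_simps)
  then have "\<epsilon> * (G Y W p * (appl \<xi> b p + 2 * b p)) = 0" by algebra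
  moreover have "\<epsilon> \<noteq> 0" by (rule epsilon(2))
  ultimately show "appl \<xi> b p = (- (2 * b)) p" using YW(4) by simp
qed

end

section \<open>Ricci solitons\<close>

lemma double_cancel: "2 * f = 2 * h \<Longrightarrow> f = h" for f h :: "'a \<Rightarrow> real"
  by (simp add: fun_eq_iff)

context pseudo_riemannian
begin

abbreviation "lie_metric V X Y \<equiv> lie_deriv2 A V g X Y"

lemma lie_metric_eq_nab:
  assumes "V \<in> VF" "X \<in> VF" "Y \<in> VF"
  shows "lie_metric V X Y = G (nab X V) Y + G (nab Y V) X"
  using assms by (simp add: lie_deriv2_def torsion_free appl_metric metric_commute)

lemma appl_metric_lie: "appl V (G X Y) = lie_metric V X Y + G (br V X) Y + G X (br V Y)"
  by (simp add: lie_deriv2_def)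

text \<open>A consequence of the Jacobi identity.\<close>

lemma lie_metric_bracket:
  assumes "U \<in> VF" "V \<in> VF" "X \<in> VF" "Y \<in> VF"
  shows "lie_metric (br U V) X Y =
    appl U (lie_metric V X Y) - lie_metric V (br U X) Y - lie_metric V X (br U Y)
    - (appl V (lie_metric U X Y) - lie_metric U (br V X) Y - lie_metric U X (br V Y))"
proof -
  have j: "br (br U V) Z = br U (br V Z) - br V (br U Z)" if "Z \<in> VF" for Z
    using bracket_jacobi[of U V Z] assms that by (simp add: algebra_simps)
  show ?thesis
    using assms by (simp add: lie_deriv2_def j appl_br)
qed

end

locale eta_einstein_soliton = eta_einstein_kenmotsu A g nab \<epsilon> \<phi> \<xi> \<eta> a b n
  for A :: "('m::{t2_space,second_countable_topology}, 'e::euclidean_space) chart set"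
    and g :: "'m bilin" and nab :: "'m connection"
    and \<epsilon> :: real and \<phi> :: "'m endo" and \<xi> :: "'m field" and \<eta> :: "'m form" and a b n +
  fixes V :: "'m field" and lam :: real
  assumes V [simp, intro]: "V \<in> fields A"
    and soliton: "\<And>X Y. X \<in> fields A \<Longrightarrow> Y \<in> fields A \<Longrightarrow>
      lie_deriv2 A V g X Y = - (2 * Ric A nab X Y) - 2 * (\<lambda>_. lam) * app2 g X Y"
begin

text \<open>The soliton equation gives \<open>(\<L>\<^bsub>V\<^esub> g)(\<xi>, X) = 2 M \<eta>(X)\<close>; in the end this constant is zero.\<close>

abbreviation M :: "'m \<Rightarrow> real" where "M \<equiv> \<lambda>_. 2 * real n - \<epsilon> * lam"

lemma lie_V_metric:
  assumes "X \<in> VF" "Y \<in> VF"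
  shows "lie_metric V X Y = 2 * E * (M + b) * G X Y - 2 * b * e X * e Y"
proof
  fix p
  have "\<epsilon> * \<epsilon> = 1" by (rule epsilon(1))
  then show "lie_metric V X Y p = (2 * E * (M + b) * G X Y - 2 * b * e X * e Y) p"
    using assms by (simp add: soliton Ric_ab a_eq) algebra
qed

lemma lie_xi_metric:
  "X \<in> VF \<Longrightarrow> Y \<in> VF \<Longrightarrow> lie_metric \<xi> X Y = 2 * (G X Y - E * e X * e Y)"
  by (simp add: lie_deriv2_def appl_xi_metric)

text \<open>The gradient of \<open>\<eta>(V)\<close>, in a form that shows its relation to the bracket \<open>[\<xi>, V]\<close>.\<close>

definition F :: "'m field" where "F = fscale (2 * M) \<xi> - fscale E (br \<xi> V)"

lemma F_VF [simp, intro]: "F \<in> VF" unfolding F_def by simp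

text \<open>The left-hand side of the soliton equation at \<open>(X, \<xi>)\<close> contains \<open>\<eta>(\<nabla>\<^bsub>X\<^esub> V)\<close>, the part of the derivative
  of \<open>\<eta>(V)\<close> that involves \<open>V\<close> to first order.\<close>

lemma F_gradient:
  assumes "X \<in> VF"
  shows "G F X = appl X (e V)"
proof -
  have "G (nab X V) \<xi> + G (nab \<xi> V) X = 2 * E * (M + b) * G X \<xi> - 2 * b * e X * e \<xi>"
    using lie_V_metric[of X \<xi>] lie_metric_eq_nab[of V X \<xi>] assms by simp
  then have "E * e (nab X V) = 2 * M * e X - G (nab \<xi> V) X"
    using assms by (simp add: algebra_simps)
  then have "E * (E * e (nab X V)) = E * (2 * M * e X - G (nab \<xi> V) X)" by simp
  then have eq: "e (nab X V) = E * (2 * M * e X - G (nab \<xi> V) X)" by simp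
  show ?thesis
    using assms by (simp add: F_def br_xi appl_eta eq metric_commute) (simp add: algebra_simps)
qed

lemma appl_V_eta:
  assumes "X \<in> VF"
  shows "appl V (e X) = e (br V X) + G F X"
  unfolding F_gradient[OF assms]
  using assms by (simp add: appl_eta torsion_free metric_commute)

text \<open>By \<open>F_gradient\<close>, \<open>\<epsilon> \<eta>(F)\<close> is the derivative of \<open>\<eta>(V)\<close> along \<open>\<xi>\<close>, which is \<open>\<eta>([\<xi>, V])\<close>; the same
  bracket occurs in \<open>F\<close> with a negative sign.\<close>

lemma eta_F: "e F = M"
proof -
  have "E * e F = e (br \<xi> V)" using F_gradient[of \<xi>] by (simp add: appl_xi_eta)
  then have "E * (E * e F) = E * e (br \<xi> V)" by simp
  then have "e F = E * e (br \<xi> V)" by simp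
  moreover have "e F = 2 * M - E * e (br \<xi> V)" unfolding F_def by simp
  ultimately have "e F = 2 * M - e F" by simp
  then have "2 * e F = 2 * M" by (simp add: eq_diff_eq)
  then show ?thesis by (rule double_cancel)
qed

text \<open>By \<open>lie_metric_bracket\<close> this follows from the Lie derivatives of the metric along \<open>V\<close>, known from the
  soliton equation, and along \<open>\<xi>\<close>.\<close>

lemma lie_br_metric:
  assumes "X \<in> VF" "Y \<in> VF"
  shows "lie_metric (br \<xi> V) X Y = 2 * E * appl \<xi> b * G X Y - (4 * M + 2 * appl \<xi> b) * e X * e Y
    + 2 * E * (G F X * e Y + e X * G F Y)"
  using assms
  by (simp add: lie_metric_bracket lie_V_metric lie_xi_metric appl_metric_lie appl_V_eta appl_xi_eta
      del: metric_xi)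
    (simp add: algebra_simps)

text \<open>Being a gradient, \<open>F\<close> has a symmetric covariant derivative, which is therefore determined by the
  Lie derivative of the metric along \<open>F\<close>, that is along \<open>\<xi>\<close> and \<open>[\<xi>, V]\<close>.\<close>

lemma hessian:
  assumes "X \<in> VF" "Y \<in> VF"
  shows "G (nab X F) Y = (2 * M - appl \<xi> b) * G X Y + E * appl \<xi> b * e X * e Y
    - (G F X * e Y + e X * G F Y)"
proof -
  have T: "G (nab X F) Y = appl X (appl Y (e V)) - appl (nab X Y) (e V)"
    if "X \<in> VF" "Y \<in> VF" for X Y
    using appl_metric[of X F Y] F_gradient that by simp
  \<comment> \<open>the covariant derivative of a gradient is symmetric\<close>
  have sym: "G (nab Y F) X = G (nab X F) Y"
    unfolding T[OF assms] T[OF assms(2,1)] using appl_br[of X Y "e V"] assms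
    by (simp add: torsion_free algebra_simps)
  have "nab Z F = fscale (2 * M) (nab Z \<xi>) - fscale E (nab Z (br \<xi> V))" if "Z \<in> VF" for Z
    using that unfolding F_def by (simp add: fscale_simps)
  then have "G (nab X F) Y + G (nab Y F) X =
      4 * M * (G X Y - E * e X * e Y) - E * lie_metric (br \<xi> V) X Y"
    using assms by (simp add: lie_metric_eq_nab metric_commute) (simp add: algebra_simps)
  then have "2 * G (nab X F) Y = 2 * ((2 * M - appl \<xi> b) * G X Y + E * appl \<xi> b * e X * e Y
    - (G F X * e Y + e X * G F Y))"
    unfolding sym lie_br_metric[OF assms] by (simp add: algebra_simps)
  then show ?thesis by (rule double_cancel)
qed

text \<open>The horizontal part of the gradient. On the leaves of the kernel of \<open>\<eta>\<close> its covariant derivative is a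
  multiple of the identity.\<close>

definition Z :: "'m field" where "Z = F - fscale M \<xi>"

text \<open>The factor of this multiple.\<close>

definition w :: "'m \<Rightarrow> real" where "w = M - appl \<xi> b"

lemma Z_VF [simp, intro]: "Z \<in> VF" unfolding Z_def by simp

lemma C_w [simp, intro]: "C w" unfolding w_def by simp

lemma eta_Z [simp]: "e Z = 0" unfolding Z_def by (simp add: eta_F)

lemma nab_Z:
  assumes "X \<in> VF"
  shows "nab X Z = fscale w (X - fscale (e X) \<xi>) - fscale (E * G X Z) \<xi> - fscale (e X) Z"
proof (rule field_eqI)
  fix Y assume Y: "Y \<in> VF"
  have FZ: "G F U = G Z U + M * (E * e U)" if "U \<in> VF" for U
    using that unfolding Z_def by simp
  have "G (nab X Z) Y = G (nab X F) Y - M * (G X Y - E * e X * e Y)"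
    using assms Y unfolding Z_def by (simp add: algebra_simps)
  also have "\<dots> = G (fscale w (X - fscale (e X) \<xi>) - fscale (E * G X Z) \<xi> - fscale (e X) Z) Y"
    unfolding hessian[OF assms Y] FZ[OF assms] FZ[OF Y]
    using assms Y by (simp add: w_def metric_commute) (simp add: algebra_simps)
  finally show "G (nab X Z) Y = \<dots>" .
qed (use assms in auto)

text \<open>In local coordinates \<open>\<alpha> = 0\<close> means that \<open>w\<close> is a constant times \<open>exp (- 2 t)\<close>, where \<open>t\<close> is the
  parameter along \<open>\<xi>\<close>.\<close>

definition \<alpha> :: "'m field \<Rightarrow> 'm \<Rightarrow> real" where "\<alpha> X = appl X w + 2 * w * e X"

lemma C_\<alpha> [simp, intro]: "X \<in> VF \<Longrightarrow> C (\<alpha> X)" unfolding \<alpha>_def by simp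

text \<open>The integrability condition of \<open>nab_Z\<close>.\<close>

lemma K_Z:
  assumes "X \<in> VF" "Y \<in> VF"
  shows "K X Y Z = fscale (\<alpha> X) (Y - fscale (e Y) \<xi>) - fscale (\<alpha> Y) (X - fscale (e X) \<xi>)"
proof (rule field_eqI)
  fix W assume W: "W \<in> VF"
  show "G (K X Y Z) W = G (fscale (\<alpha> X) (Y - fscale (e Y) \<xi>) - fscale (\<alpha> Y) (X - fscale (e X) \<xi>)) W"
    using assms W
    by (simp add: K_def \<alpha>_def curvature_def torsion_free nab_Z appl_eta appl_metric metric_commute)
      (simp add: algebra_simps)
qed (use assms in auto)

text \<open>Pair symmetry turns \<open>K_Z\<close> into a formula for the operator \<open>K(Z, W)\<close>, which commutes with \<open>\<phi>\<close>.\<close>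

lemma \<alpha>_phi_identity:
  assumes "X \<in> VF" "Y \<in> VF" "W \<in> VF"
  shows "\<alpha> (P X) * (G Y W - E * e Y * e W) - \<alpha> Y * G (P X) W
    + \<alpha> X * G (P Y) W - \<alpha> (P Y) * (G X W - E * e X * e W) = 0"
proof -
  have KZ: "G (K Z W X) Y = \<alpha> X * (G Y W - E * e Y * e W) - \<alpha> Y * (G X W - E * e X * e W)"
    if "X \<in> VF" "Y \<in> VF" for X Y
  proof -
    have "G (K Z W X) Y = G (K X Y Z) W"
      using K_pair_symmetry[of X Y Z W] that assms by simp
    then show ?thesis using that assms by (simp add: K_Z algebra_simps)
  qed
  have "G (K Z W (P X)) Y = - G (K Z W X) (P Y)"
    using assms by (simp add: K_phi metric_phi_skew)
  then show ?thesis
    using assms by (simp add: KZ)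
qed

text \<open>Choose \<open>Y \<noteq> 0\<close> in the common kernel of \<open>\<alpha>\<close>, \<open>\<alpha> \<circ> \<phi>\<close> and \<open>\<eta>\<close>. The identity above becomes
  \<open>\<alpha>(\<phi> X) Y + \<alpha>(X) \<phi> Y = 0\<close>, and \<open>Y\<close>, \<open>\<phi> Y\<close> are linearly independent because \<open>\<phi>\<^sup>2 Y = - Y\<close>.\<close>

lemma \<alpha>_zero:
  assumes X: "X \<in> VF"
  shows "\<alpha> X = 0"
proof
  fix p
  let ?T = "tangent_space A p"
  let ?\<alpha> = "\<lambda>v. v w + 2 * w p * \<eta> p v"
  have \<alpha>: "?\<alpha> (X p) = \<alpha> X p" for X by (simp add: \<alpha>_def app1_def appl_def)
  have \<eta>: "lin_on ?T (\<eta> p)" and \<phi>: "lin_on ?T (\<phi> p)" "\<phi> p ` ?T \<subseteq> ?T"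
    using contact by (simp_all add: almost_contact_pseudo_metric_def one_form_def endo_field_def)
  have l1: "lin_on ?T ?\<alpha>"
    using \<eta> unfolding lin_on_def by (simp add: scaleR_fun_def algebra_simps)
  have l2: "lin_on ?T (\<lambda>v. ?\<alpha> (\<phi> p v))"
    using l1 \<phi> unfolding lin_on_def by (simp add: image_subset_iff)
  obtain v where v: "v \<in> ?T" "v \<noteq> 0" "?\<alpha> v = 0" "?\<alpha> (\<phi> p v) = 0" "\<eta> p v = 0"
    using common_kernel_vector[OF dim(1) l1 l2 \<eta>] by blast
  obtain Y where Y: "Y \<in> VF" "Y p = v" using field_extension[OF v(1)] by blast
  have Y0: "\<alpha> Y p = 0" "\<alpha> (P Y) p = 0" "e Y p = 0"
    using v(3-5) unfolding Y(2)[symmetric] \<alpha>[symmetric] by (simp_all add: app1_def appE_def)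
  let ?s = "\<alpha> (P X) p" and ?t = "\<alpha> X p"
  \<comment> \<open>The identity for \<open>W\<close> and for \<open>\<phi> W\<close> are the two rows of a system with determinant \<open>?s\<^sup>2 + ?t\<^sup>2\<close>.\<close>
  have 1: "?s * G Y W p + ?t * G (P Y) W p = 0" if "W \<in> VF" for W
    using fun_cong[OF \<alpha>_phi_identity[OF X Y(1) that], of p] Y0 by simp
  have "Y p \<noteq> 0" using v Y by simp
  then obtain W where W: "W \<in> VF" "G Y W p \<noteq> 0" using metric_nondegenerate[OF Y(1)] by blast
  have "?s * - G (P Y) W p + ?t * G Y W p = 0"
    using 1[of "P W"] W Y Y0 by (simp add: metric_phi_phi metric_phi_skew)
  then have "(?s\<^sup>2 + ?t\<^sup>2) * G Y W p = 0"
    using 1[OF W(1)] by algebra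
  then show "?t = 0 p" using W(2) by (simp add: sum_power2_eq_zero_iff)
qed

lemma K_Z_zero: "X \<in> VF \<Longrightarrow> Y \<in> VF \<Longrightarrow> K X Y Z = 0"
  by (simp add: K_Z \<alpha>_zero fscale_simps)

text \<open>The trace over \<open>X\<close> of \<open>K(X, Y) Z = 0\<close> says that \<open>Ric(Y, Z) = - 2 n \<epsilon> g(Y, Z)\<close>.\<close>

lemma b_Z:
  assumes "Y \<in> VF"
  shows "b * G Y Z = 0"
proof
  fix p
  let ?h = "- (E * G Y Z)"
  have R: "R X Y Z = fscale ?h X + fscale (E * G X Z) Y" if "X \<in> VF" for X
  proof (rule field_eqI)
    fix W assume "W \<in> VF"
    have "G (K X Y Z) W = 0" using K_Z_zero that assms \<open>W \<in> VF\<close> by simp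
    then show "G (R X Y Z) W = G (fscale ?h X + fscale (E * G X Z) Y) W"
      using that assms \<open>W \<in> VF\<close> by (simp add: K_def algebra_simps)
  qed (use that assms in auto)
  have "Ric A nab Y Z p = trace (\<lambda>X. fscale ?h X + fscale (E * G X Z) Y) p"
    unfolding Ric_eq_trace
    by (rule trace_cong(2)[symmetric, OF tensorial_curvature]) (use assms in \<open>simp_all add: R\<close>)
  also have "\<dots> = ?h p * DIM('e) + (E * G Y Z) p"
    using assms
    by (simp only: trace_add[OF tensorial_scalar metric_rank_one(2)] trace_scalar metric_rank_one(1)
        C_simps C_metric Z_VF)
  finally have "\<epsilon> * (b p * G Y Z p) = 0"
    using assms by (simp add: Ric_ab a_eq dim algebra_simps)
  moreover have "\<epsilon> \<noteq> 0" by (rule epsilon(2))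
  ultimately show "(b * G Y Z) p = 0 p" by simp
qed

text \<open>With \<open>\<xi> b = - 2 b\<close> one has \<open>w = M + 2 b\<close>, and \<open>\<alpha>(\<xi>) = \<xi> w + 2 w = 2 M\<close>.\<close>

lemma w_eq: "w = 2 * b"
proof -
  have w: "w = M + 2 * b" unfolding w_def appl_xi_b by simp
  have "\<alpha> \<xi> = 0" by (rule \<alpha>_zero) simp
  then have "2 * M = 0" unfolding \<alpha>_def w by (simp add: appl_xi_b algebra_simps)
  then show ?thesis unfolding w by (simp add: fun_eq_iff)
qed

text \<open>Differentiating \<open>b g(Y, Z) = 0\<close> and multiplying by \<open>b\<close> leaves \<open>b\<^sup>2 g(Y, \<nabla>\<^bsub>X\<^esub> Z) = 0\<close>; for horizontal \<open>Y\<close>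
  this is \<open>2 b\<^sup>3 g(Y, X) = 0\<close>. The factor \<open>b\<close> replaces a restriction to the open set where \<open>b \<noteq> 0\<close>.\<close>

lemma b_zero: "b p = 0"
proof -
  obtain Y X where YX: "Y \<in> VF" "X \<in> VF" "e Y p = 0" "G Y X p \<noteq> 0" by (rule horizontal_pair)
  have "appl X (b * G Y Z) = 0" unfolding b_Z[OF YX(1)] using YX by simp
  then have "appl X b * G Y Z + b * G (nab X Y) Z + b * G Y (nab X Z) = 0"
    using YX by (simp add: appl_metric algebra_simps)
  then have "b * (appl X b * G Y Z + b * G (nab X Y) Z + b * G Y (nab X Z)) = 0" by simp
  moreover have "b * (appl X b * G Y Z) = appl X b * (b * G Y Z)" by (simp add: algebra_simps)
  ultimately have "b * (b * G Y (nab X Z)) = 0"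
    using b_Z[OF YX(1)] b_Z[of "nab X Y"] YX by (simp add: distrib_left)
  then have "(b * (b * G Y (nab X Z))) p = 0" by simp
  moreover have "(b * G Y Z) p = 0" using b_Z[OF YX(1)] by simp
  ultimately have "b p * (b p * (b p * G Y X p)) = 0"
    using YX by (simp add: nab_Z w_eq algebra_simps) auto
  then show ?thesis using YX(4) by simp
qed

end

theorem theorem7:
  fixes A :: "('m::{t2_space,second_countable_topology}, 'e::euclidean_space) chart set"
    and \<epsilon> :: real
    and \<phi> :: "'m endo" and \<xi> :: "'m field" and \<eta> :: "'m form" and g :: "'m bilin"
    and nab :: "'m connection" and V :: "'m field" and n :: nat
  assumes "smooth_atlas A"
    and "DIM('e) = 2 * n + 1" and "n \<ge> 1" and "DIM('e) > 3"
    and "kenmotsu_pseudo_metric A \<epsilon> \<phi> \<xi> \<eta> g nab"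
    and "eta_einstein A \<eta> g nab"
    and "ricci_soliton A g nab V"
  shows "einstein A \<eta> g nab"
proof -
  obtain a b where ab: "eta_einstein_with A \<eta> g nab a b"
    using assms(6) unfolding eta_einstein_def by blast
  obtain lam where V: "V \<in> fields A" and sol: "\<And>X Y p. X \<in> fields A \<Longrightarrow> Y \<in> fields A \<Longrightarrow>
      lie_deriv2 A V g X Y p + 2 * Ric A nab X Y p + 2 * lam * app2 g X Y p = 0"
    using assms(7) unfolding ricci_soliton_def by blast
  interpret eta_einstein_soliton A g nab \<epsilon> \<phi> \<xi> \<eta> a b n V lam
  proof
    show "smooth_atlas A" "kenmotsu_pseudo_metric A \<epsilon> \<phi> \<xi> \<eta> g nab" "DIM('e) = 2 * n + 1"
      "eta_einstein_with A \<eta> g nab a b" "V \<in> fields A" by fact+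
    show "n \<ge> 2" using assms(2,4) by simp
    show "pseudo_metric A g" "levi_civita A g nab"
      using assms(5) by (simp_all add: kenmotsu_pseudo_metric_def almost_contact_pseudo_metric_def)
    show "lie_deriv2 A V g X Y = - (2 * Ric A nab X Y) - 2 * (\<lambda>_. lam) * app2 g X Y"
      if "X \<in> fields A" "Y \<in> fields A" for X Y
    proof
      show "lie_deriv2 A V g X Y p = (- (2 * Ric A nab X Y) - 2 * (\<lambda>_. lam) * app2 g X Y) p" for p
        using sol[OF that, of p] by (simp add: algebra_simps)
    qed
  qed
  have "b = (\<lambda>p. 0)" using b_zero by blast
  then show ?thesis using ab unfolding einstein_def by blast
qed

end
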